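(* Let $G$ be a finite abelian group of order $N$, let $S \subseteq G\setminus\{0\}$ satisfy $S=-S$, and let $K$ be a field with $\operatorname{char}(K)\nmid N$. Then: (i) $m_{G,S,K}(x)=\prod_{\mathcal{O}\in\mathcal{O}_K(G,S)}\Psi_{\mathcal{O},K}(x)$, and this is a squarefree product of distinct monic irreducible polynomials over $K$; (ii) there is a $K$-algebra isomorphism $\mathcal{A}_K(\mathrm{Cay}(G,S))\cong\prod_{\mathcal{O}\in\mathcal{O}_K(G,S)}K[x]/(\Psi_{\mathcal{O},K}(x))$; (iii) $\mathcal{A}_K(\mathrm{Cay}(G,S))$ is semisimple; (iv) if $K=\mathbb{Q}$, every factor $\mathbb{Q}[x]/(\Psi_{\mathcal{O},\mathbb{Q}}(x))$ is a number field isomorphic to a subfield of $\mathbb{Q}(\zeta_N)^+$.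
   Context: $G$ is written additively. $\mathrm{Cay}(G,S)$ is the graph with vertex set $G$ and edges $\{g,g+s\}$ for $g\in G$, $s\in S$. Its adjacency matrix $A$, with rows and columns indexed by $G$, has $A_{g,h}=1$ if $h-g\in S$ and $A_{g,h}=0$ otherwise; it is regarded as a matrix over $K$. The spectral algebra is $\mathcal{A}_K(\mathrm{Cay}(G,S))=K[A]=\{f(A):f\in K[x]\}\subseteq M_N(K)$, and $m_{G,S,K}\in K[x]$ is the minimal polynomial of $A$ over $K$. $\overline{K}$ is an algebraic closure of $K$, $\widehat{G}=\mathrm{Hom}(G,\overline{K}^* )$, and $\lambda_\chi=\sum_{s\in S}\chi(s)\in\overline{K}$ for $\chi\in\widehat{G}$. $\mathcal{O}_K(G,S)$ is the partition of the set $\{\lambda_\chi:\chi\in\widehat{G}\}$ into orbits of $\mathrm{Gal}(\overline{K}/K)$ (the group of $K$-automorphisms of $\overline{K}$). For an orbit $\mathcal{O}$, $\Psi_{\mathcal{O},K}$ is the monic minimal polynomial over $K$ of any element of $\mathcal{O}$. $\zeta_N$ is a primitive $N$-th root of unity in $\mathbb{C}$ and $\mathbb{Q}(\zeta_N)^+=\mathbb{Q}(\zeta_N+\zeta_N^{-1})=\mathbb{Q}(\zeta_N)\cap\mathbb{R}$. *)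

theory Defs
  imports
    "HOL-Algebra.Algebraic_Closure_Type"
    "HOL-Algebra.Generated_Fields"
    "HOL-Algebra.Group_Action"
    "HOL-Computational_Algebra.Squarefree"
    "HOL-Analysis.Finite_Cartesian_Product"
begin

text \<open>
  A finite abelian group, written additively, is a type of sort
  \<open>{finite, ab_group_add}\<close>; its order is \<open>CARD('g)\<close>. The field \<open>K\<close> is a type \<open>'k\<close> of class
  \<open>field\<close>, and \<open>'k alg_closure\<close> with the embedding \<open>to_ac\<close> is its algebraic closure.
\<close>

subsection \<open>Polynomials in a matrix\<close>

type_synonym ('k, 'g) sq_matrix = "(('k, 'g) vec, 'g) vec"

primrec matrix_pow :: "('k::comm_ring_1, 'g::finite) sq_matrix \<Rightarrow> nat \<Rightarrow> ('k, 'g) sq_matrix" where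
  "matrix_pow A 0 = mat 1"
| "matrix_pow A (Suc n) = A ** matrix_pow A n"

definition matrix_smult :: "'k::comm_ring_1 \<Rightarrow> ('k, 'g::finite) sq_matrix \<Rightarrow> ('k, 'g) sq_matrix" where
  "matrix_smult c A = map_matrix (\<lambda>a. c * a) A"

definition poly_matrix :: "'k::comm_ring_1 poly \<Rightarrow> ('k, 'g::finite) sq_matrix \<Rightarrow> ('k, 'g) sq_matrix" where
  "poly_matrix f A = (\<Sum>i\<le>Polynomial.degree f. matrix_smult (Polynomial.coeff f i) (matrix_pow A i))"

definition matrix_min_poly :: "('k::field, 'g::finite) sq_matrix \<Rightarrow> 'k poly" where
  "matrix_min_poly A = (THE p. Polynomial.lead_coeff p = 1 \<and> poly_matrix p A = 0 \<and>
     (\<forall>q. poly_matrix q A = 0 \<longrightarrow> p dvd q))"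

definition matrix_generated_algebra :: "('k::field, 'g::finite) sq_matrix \<Rightarrow> ('k, ('k, 'g) sq_matrix) module" where
  "matrix_generated_algebra A =
     \<lparr> carrier = range (\<lambda>f. poly_matrix f A), monoid.mult = (**), one = mat 1,
       zero = 0, add = (+), module.smult = matrix_smult \<rparr>"

subsection \<open>Cayley graphs\<close>

definition cayley_matrix :: "'g::{finite,ab_group_add} set \<Rightarrow> ('k::field, 'g) sq_matrix" where
  "cayley_matrix S = (\<chi> g h. if h - g \<in> S then 1 else 0)"

definition spectral_algebra ::
    "'g::{finite,ab_group_add} set \<Rightarrow> ('k::field, ('k, 'g) sq_matrix) module" where
  "spectral_algebra S = matrix_generated_algebra (cayley_matrix S)"

definition cayley_min_poly :: "'g::{finite,ab_group_add} set \<Rightarrow> 'k::field poly" where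
  "cayley_min_poly S = matrix_min_poly (cayley_matrix S :: ('k, 'g) sq_matrix)"

subsection \<open>Characters, eigenvalues and Galois orbits\<close>

definition characters :: "('g::ab_group_add \<Rightarrow> 'k::field alg_closure) set" where
  "characters = {\<psi>. (\<forall>g. \<psi> g \<noteq> 0) \<and> (\<forall>g h. \<psi> (g + h) = \<psi> g * \<psi> h)}"

definition eigenvalues :: "'g::ab_group_add set \<Rightarrow> 'k::field alg_closure set" where
  "eigenvalues S = (\<lambda>\<psi>. \<Sum>s\<in>S. \<psi> s) ` characters"

definition galois_group :: "('k::field alg_closure \<Rightarrow> 'k alg_closure) monoid" where
  "galois_group =
     \<lparr> carrier = {\<sigma> \<in> ring_iso ring_of_type_algebra ring_of_type_algebra. \<forall>c. \<sigma> (to_ac c) = to_ac c},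
       monoid.mult = (\<circ>), one = id \<rparr>"

definition eigenvalue_orbits :: "'g::ab_group_add set \<Rightarrow> 'k::field alg_closure set set" where
  "eigenvalue_orbits S = orbits galois_group (eigenvalues S) (\<lambda>\<sigma>. \<sigma>)"

definition min_poly_over :: "'k::field alg_closure \<Rightarrow> 'k poly" where
  "min_poly_over x = (THE p. Polynomial.lead_coeff p = 1 \<and> poly (map_poly to_ac p) x = 0 \<and>
     (\<forall>q. poly (map_poly to_ac q) x = 0 \<longrightarrow> p dvd q))"

text \<open>The common value of \<open>min_poly_over\<close> on the orbit.\<close>

definition orbit_poly :: "'k::field alg_closure set \<Rightarrow> 'k poly" where
  "orbit_poly \<O> = (THE p. \<forall>x\<in>\<O>. min_poly_over x = p)"

subsection \<open>Algebras\<close>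

definition algebra_isomorphic ::
    "('k, 'm) ring_scheme \<Rightarrow> ('k, 'a, 'n) module_scheme \<Rightarrow> ('k, 'b, 'l) module_scheme \<Rightarrow> bool" where
  "algebra_isomorphic R A B \<longleftrightarrow> Module.algebra R A \<and> Module.algebra R B \<and>
     (\<exists>h \<in> ring_iso A B. \<forall>c\<in>carrier R. \<forall>x\<in>carrier A. h (c \<odot>\<^bsub>A\<^esub> x) = c \<odot>\<^bsub>B\<^esub> h x)"

text \<open>Scalars act on \<open>K[x]/(p)\<close> through the classes of the constant polynomials.\<close>

definition poly_quotient :: "'k::field poly \<Rightarrow> ('k, 'k poly set) module" where
  "poly_quotient p =
     (let P = (ring_of_type_algebra :: 'k poly ring); I = PIdl\<^bsub>P\<^esub> p; Q = P Quot I in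
     \<lparr> carrier = carrier Q, monoid.mult = monoid.mult Q, one = one Q, zero = zero Q, add = add Q,
       module.smult = (\<lambda>c u. (I +>\<^bsub>P\<^esub> [:c:]) \<otimes>\<^bsub>Q\<^esub> u) \<rparr>)"

definition product_algebra :: "'i set \<Rightarrow> ('i \<Rightarrow> ('k, 'a) module) \<Rightarrow> ('k, 'i \<Rightarrow> 'a) module" where
  "product_algebra J M =
     \<lparr> carrier = (\<Pi>\<^sub>E i\<in>J. carrier (M i)),
       monoid.mult = (\<lambda>x y. \<lambda>i\<in>J. x i \<otimes>\<^bsub>M i\<^esub> y i),
       one = (\<lambda>i\<in>J. \<one>\<^bsub>M i\<^esub>),
       zero = (\<lambda>i\<in>J. \<zero>\<^bsub>M i\<^esub>),
       add = (\<lambda>x y. \<lambda>i\<in>J. x i \<oplus>\<^bsub>M i\<^esub> y i),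
       module.smult = (\<lambda>c x. \<lambda>i\<in>J. c \<odot>\<^bsub>M i\<^esub> x i) \<rparr>"

definition left_ideal :: "'a set \<Rightarrow> ('a, 'm) ring_scheme \<Rightarrow> bool" where
  "left_ideal I R \<longleftrightarrow> additive_subgroup I R \<and> (\<forall>a\<in>I. \<forall>r\<in>carrier R. r \<otimes>\<^bsub>R\<^esub> a \<in> I)"

text \<open>
  A ring is semisimple if it is semisimple as a left module over itself, i.e. every submodule
  of the regular module is a direct summand.
\<close>

definition semisimple_ring :: "('a, 'm) ring_scheme \<Rightarrow> bool" where
  "semisimple_ring R \<longleftrightarrow> ring R \<and>
     (\<forall>I. left_ideal I R \<longrightarrow>
        (\<exists>J. left_ideal J R \<and> I \<inter> J = {\<zero>\<^bsub>R\<^esub>} \<and> I <+>\<^bsub>R\<^esub> J = carrier R))"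

subsection \<open>Number fields\<close>

definition number_field :: "(rat, 'a, 'm) module_scheme \<Rightarrow> bool" where
  "number_field M \<longleftrightarrow> Module.algebra (ring_of_type_algebra :: rat ring) M \<and> field M \<and>
     ring.finite_dimension M (range (\<lambda>q. q \<odot>\<^bsub>M\<^esub> \<one>\<^bsub>M\<^esub>)) (carrier M)"

definition primitive_root_of_unity :: "nat \<Rightarrow> complex \<Rightarrow> bool" where
  "primitive_root_of_unity n z \<longleftrightarrow> z ^ n = 1 \<and> (\<forall>k. 0 < k \<and> k < n \<longrightarrow> z ^ k \<noteq> 1)"

definition rational_adjoin :: "complex \<Rightarrow> complex set" where
  "rational_adjoin z = generate_field ring_of_type_algebra (\<rat> \<union> {z})"

end

theory Submission
  imports Defs
begin

text \<open>
  The characters of \<open>G\<close> with values in an algebraically closed field \<open>L \<supseteq> K\<close> are eigenvectors of the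
  adjacency matrix \<open>A\<close>, with eigenvalues \<open>\<lambda>\<^sub>\<chi>\<close>. Every \<open>f(A)\<close> is translation invariant, hence is
  determined by one row, and the Fourier transform of that row is \<open>\<chi> \<mapsto> f(\<lambda>\<^sub>\<chi>)\<close>. As the
  characteristic does not divide \<open>N\<close>, the Fourier transform is injective, so \<open>f(A) = 0\<close> if and only if
  \<open>f\<close> vanishes at all \<open>\<lambda>\<^sub>\<chi>\<close>, that is, if and only if all \<open>\<Psi>\<^sub>\<O>\<close> divide \<open>f\<close>. This identifies the
  minimal polynomial; the algebra isomorphism is the Chinese remainder theorem, and semisimplicity
  follows because \<open>K[x]/(m)\<close> with \<open>m\<close> squarefree has complements of ideals. Distinct orbits have
  distinct minimal polynomials because isomorphisms of subfields extend to the algebraic closure.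

  For \<open>K = \<rat>\<close> the vanishing criterion with \<open>L = \<complex>\<close> shows that every \<open>\<Psi>\<^sub>\<O>\<close> has a root of the
  form \<open>\<Sum>s\<in>S. \<chi> s\<close> for a complex character \<open>\<chi>\<close>. Pairing \<open>s\<close> with \<open>-s\<close> puts this root into
  \<open>\<rat>(\<zeta> + \<zeta>\<^sup>-\<^sup>1)\<close>.
\<close>

subsection \<open>Comaximal polynomials\<close>

text \<open>Ideals are kept as plain sets of polynomials, so that kernels of evaluation maps and
  preimages of left ideals need only three closure checks.\<close>

definition poly_ideal :: "'a::field poly set \<Rightarrow> bool" where
  "poly_ideal I \<longleftrightarrow> 0 \<in> I \<and> (\<forall>f\<in>I. \<forall>g\<in>I. f + g \<in> I) \<and> (\<forall>f\<in>I. \<forall>q. q * f \<in> I)"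

text \<open>A nonzero element of least degree divides all others, because remainders stay in the
  ideal. The zero ideal gets the generator 0.\<close>

lemma poly_ideal_principal:
  fixes I :: "'a::field poly set"
  assumes "poly_ideal I"
  obtains d where "\<And>f. f \<in> I \<longleftrightarrow> d dvd f"
proof (cases "I \<subseteq> {0}")
  case True
  then have "f \<in> I \<longleftrightarrow> 0 dvd f" for f
    using assms by (auto simp: poly_ideal_def)
  then show ?thesis by (rule that)
next
  case False
  define P where "P d \<longleftrightarrow> d \<in> I \<and> d \<noteq> 0" for d
  obtain d0 where "P d0" using False by (auto simp: P_def)
  then obtain d where d: "P d" and least: "\<And>g. P g \<Longrightarrow> Polynomial.degree d \<le> Polynomial.degree g"
    using ex_has_least_nat[of P d0 Polynomial.degree] by blast
  have "d dvd f" if "f \<in> I" for f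
  proof (rule ccontr)
    assume "\<not> d dvd f"
    then have nz: "f mod d \<noteq> 0" by (simp add: dvd_eq_mod_eq_0)
    have "f mod d = f + (- (f div d)) * d" by (simp add: minus_div_mult_eq_mod[symmetric])
    then have "f mod d \<in> I"
      using assms that d by (simp add: poly_ideal_def P_def del: mult_minus_left)
    with nz have "P (f mod d)" by (simp add: P_def)
    from least[OF this] show False
      using degree_mod_less'[of d f] d nz by (auto simp: P_def)
  qed
  moreover have "f \<in> I" if "d dvd f" for f
  proof -
    obtain q where "f = d * q" using \<open>d dvd f\<close> by (elim dvdE)
    then show ?thesis using d assms by (simp add: P_def poly_ideal_def mult.commute)
  qed
  ultimately have "f \<in> I \<longleftrightarrow> d dvd f" for f by blast
  then show ?thesis by (rule that)
qed

lemma monic_dvd_antisym: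
  fixes p q :: "'a::field poly"
  assumes "Polynomial.lead_coeff p = 1" "Polynomial.lead_coeff q = 1" "p dvd q" "q dvd p"
  shows "p = q"
proof -
  obtain u where u: "q = p * u" using assms(3) by (elim dvdE)
  have nz: "p \<noteq> 0" "q \<noteq> 0" "u \<noteq> 0" using assms u by auto
  have "Polynomial.degree q \<le> Polynomial.degree p"
    using assms(4) nz by (simp add: dvd_imp_degree_le)
  then have "Polynomial.degree u = 0" using u nz by (simp add: degree_mult_eq)
  then obtain c where c: "u = [:c:]" by (rule degree_eq_zeroE)
  have "Polynomial.lead_coeff q = Polynomial.lead_coeff p * c" using u c by (simp add: lead_coeff_mult)
  then have "c = 1" using assms(1,2) by simp
  then show ?thesis using u c by simp
qed

text \<open>The generator is scaled to be monic. The form with unique existence is what the definite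
  description in \<open>min_poly_over\<close> needs.\<close>

lemma poly_ideal_monic_generator:
  fixes I :: "'a::field poly set"
  assumes "poly_ideal I" "f0 \<in> I" "f0 \<noteq> 0"
  shows "\<exists>!d. Polynomial.lead_coeff d = 1 \<and> d \<in> I \<and> (\<forall>f. f \<in> I \<longrightarrow> d dvd f)"
proof -
  obtain d where d: "\<And>f. f \<in> I \<longleftrightarrow> d dvd f" using poly_ideal_principal[OF assms(1)] by blast
  have nz: "d \<noteq> 0" using d[of f0] assms by auto
  define m where "m = Polynomial.smult (inverse (Polynomial.lead_coeff d)) d"
  have m: "Polynomial.lead_coeff m = 1" using nz by (simp add: m_def)
  have "m dvd f \<longleftrightarrow> d dvd f" for f
    unfolding m_def using nz by (simp add: smult_dvd_iff)
  then have mI: "f \<in> I \<longleftrightarrow> m dvd f" for f using d by simp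
  show ?thesis
  proof (rule ex1I[of _ m])
    show "Polynomial.lead_coeff m = 1 \<and> m \<in> I \<and> (\<forall>f. f \<in> I \<longrightarrow> m dvd f)"
      using m by (simp add: mI)
  next
    fix q assume "Polynomial.lead_coeff q = 1 \<and> q \<in> I \<and> (\<forall>f. f \<in> I \<longrightarrow> q dvd f)"
    then show "q = m" using m by (intro monic_dvd_antisym) (simp_all add: mI)
  qed
qed

section \<open>Bezout identities and the Chinese remainder theorem\<close>

definition comaximal :: "'a::comm_semiring_1 \<Rightarrow> 'a \<Rightarrow> bool" where
  "comaximal p q \<longleftrightarrow> (\<exists>u v. u * p + v * q = 1)"

lemma comaximal_sym: "comaximal p q \<Longrightarrow> comaximal q p"
  unfolding comaximal_def by (subst add.commute) blast

lemma comaximal_1_right [simp]: "comaximal p 1"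
  unfolding comaximal_def by (rule exI[of _ 0], rule exI[of _ 1]) simp

text \<open>Multiply the two Bezout identities: every term of the product contains \<open>p\<close>
  except the one with \<open>q * r\<close>.\<close>

lemma comaximal_mult_right:
  fixes p q r :: "'a::comm_ring_1"
  assumes "comaximal p q" "comaximal p r"
  shows "comaximal p (q * r)"
proof -
  obtain u v where uv: "u * p + v * q = 1" using assms(1) unfolding comaximal_def by auto
  obtain s t where st: "s * p + t * r = 1" using assms(2) unfolding comaximal_def by auto
  have "(u * p * s + u * t * r + v * q * s) * p + (v * t) * (q * r) = (u * p + v * q) * (s * p + t * r)"
    by (simp add: algebra_simps)
  then show ?thesis unfolding comaximal_def uv st mult_1_right by blast
qed

lemma comaximal_prod_right:
  fixes f :: "'i \<Rightarrow> 'a::comm_ring_1"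
  assumes "\<And>i. i \<in> J \<Longrightarrow> comaximal p (f i)"
  shows "comaximal p (\<Prod>i\<in>J. f i)"
  using assms by (induction J rule: infinite_finite_induct) (auto intro: comaximal_mult_right)

text \<open>Write \<open>f = f * (u * p + v * q)\<close>; each of the two summands is a multiple of
  \<open>p * q\<close>.\<close>

lemma comaximal_mult_dvd:
  fixes p q f :: "'a::comm_ring_1"
  assumes "comaximal p q" "p dvd f" "q dvd f"
  shows "p * q dvd f"
proof -
  obtain u v where uv: "u * p + v * q = 1" using assms(1) unfolding comaximal_def by auto
  have "p * q dvd u * (p * f) + v * (f * q)"
    using assms(2,3) by (intro dvd_add dvd_mult mult_dvd_mono) auto
  also have "u * (p * f) + v * (f * q) = f * (u * p + v * q)" by (simp add: algebra_simps)
  finally show ?thesis by (simp add: uv)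
qed

lemma comaximal_dvd_imp_unit:
  fixes p q :: "'a::comm_ring_1"
  assumes "comaximal p q" "p dvd q"
  shows "p dvd 1"
proof -
  obtain u v where uv: "u * p + v * q = 1" using assms(1) unfolding comaximal_def by auto
  have "p dvd u * p + v * q" using assms(2) by (intro dvd_add dvd_mult) auto
  then show ?thesis by (simp add: uv)
qed

text \<open>This later turns vanishing at the eigenvalues of every orbit into divisibility by a
  single product.\<close>

lemma comaximal_prod_dvd_iff:
  fixes P :: "'i \<Rightarrow> 'a::comm_ring_1"
  assumes "finite J" "\<And>i j. i \<in> J \<Longrightarrow> j \<in> J \<Longrightarrow> i \<noteq> j \<Longrightarrow> comaximal (P i) (P j)"
  shows "(\<Prod>i\<in>J. P i) dvd f \<longleftrightarrow> (\<forall>i\<in>J. P i dvd f)"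
  using assms
proof (induction J)
  case (insert i J)
  have "comaximal (P i) (\<Prod>j\<in>J. P j)"
    using insert by (intro comaximal_prod_right) auto
  then have "P i * (\<Prod>j\<in>J. P j) dvd f \<longleftrightarrow> P i dvd f \<and> (\<Prod>j\<in>J. P j) dvd f"
    by (auto intro: comaximal_mult_dvd dest: dvd_mult_left dvd_mult_right)
  then show ?case using insert by simp
qed simp

lemma chinese_remainder:
  fixes P :: "'i \<Rightarrow> 'a::comm_ring_1"
  assumes "finite J" "\<And>i j. i \<in> J \<Longrightarrow> j \<in> J \<Longrightarrow> i \<noteq> j \<Longrightarrow> comaximal (P i) (P j)"
  shows "\<exists>f. \<forall>i\<in>J. P i dvd f - r i"
  using assms
proof (induction J)
  case (insert i J)
  obtain f where f: "\<forall>j\<in>J. P j dvd f - r j" using insert by auto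
  have "comaximal (P i) (\<Prod>j\<in>J. P j)"
    using insert by (intro comaximal_prod_right) auto
  then obtain u v where uv: "u * P i + v * (\<Prod>j\<in>J. P j) = 1" unfolding comaximal_def by auto
  \<comment> \<open>The factor \<open>v * (\<Prod>j\<in>J. P j)\<close> is 1 modulo
    \<open>P i\<close> and 0 modulo every \<open>P j\<close> with \<open>j \<in> J\<close>, so the
    correction changes only the residue at \<open>i\<close>.\<close>
  define g where "g = f + (r i - f) * (v * (\<Prod>j\<in>J. P j))"
  have v: "v * (\<Prod>j\<in>J. P j) = 1 - u * P i" using uv by (simp add: algebra_simps)
  have "g - r i = (f - r i) * u * P i"
    unfolding g_def v by (simp add: algebra_simps)
  then have "P i dvd g - r i" by simp
  moreover have "P j dvd g - r j" if "j \<in> J" for j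
  proof -
    have "P j dvd (f - r j) + (r i - f) * (v * (\<Prod>j\<in>J. P j))"
      using f that insert.hyps by (intro dvd_add dvd_mult) (auto simp: dvd_prodI)
    then show ?thesis by (simp add: g_def algebra_simps)
  qed
  ultimately show ?case by auto
qed simp

text \<open>The ideal generated by \<open>p\<close> and \<open>q\<close> is principal. Its generator
  is a common divisor, hence a unit, so the ideal contains 1.\<close>

lemma comaximal_if_common_divisors_units:
  fixes p q :: "'a::field poly"
  assumes "\<And>c. c dvd p \<Longrightarrow> c dvd q \<Longrightarrow> c dvd 1"
  shows "comaximal p q"
proof -
  define I where "I = {u * p + v * q |u v. True}"
  have "poly_ideal I"
    unfolding poly_ideal_def
  proof (intro conjI ballI allI)
    have "0 = 0 * p + 0 * q" by simp
    then show "0 \<in> I" unfolding I_def by blast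
  next
    fix f g assume "f \<in> I" "g \<in> I"
    then obtain u v s t where "f = u * p + v * q" "g = s * p + t * q" unfolding I_def by auto
    then have "f + g = (u + s) * p + (v + t) * q" by (simp add: algebra_simps)
    then show "f + g \<in> I" unfolding I_def by blast
  next
    fix f r assume "f \<in> I"
    then obtain u v where "f = u * p + v * q" unfolding I_def by auto
    then have "r * f = (r * u) * p + (r * v) * q" by (simp add: algebra_simps)
    then show "r * f \<in> I" unfolding I_def by blast
  qed
  then obtain d where d: "\<And>f. f \<in> I \<longleftrightarrow> d dvd f" using poly_ideal_principal by blast
  have "p = 1 * p + 0 * q" "q = 0 * p + 1 * q" by simp_all
  then have "p \<in> I" "q \<in> I" unfolding I_def by blast+
  then have "d dvd 1" by (intro assms) (simp_all add: d)
  then have "1 \<in> I" by (simp add: d)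
  then show ?thesis unfolding I_def comaximal_def by auto
qed

text \<open>A common divisor \<open>c\<close> of \<open>p\<close> and \<open>f\<close> is a unit or
  an associate of \<open>p\<close>; the latter would make \<open>p\<close> divide
  \<open>f\<close>.\<close>

lemma irreducible_not_dvd_imp_comaximal:
  fixes p :: "'a::field poly"
  assumes "Factorial_Ring.irreducible p" "\<not> p dvd f"
  shows "comaximal p f"
proof (rule comaximal_if_common_divisors_units)
  fix c assume c: "c dvd p" "c dvd f"
  from c(1) obtain e where e: "p = c * e" by (elim dvdE)
  with assms(1) consider "c dvd 1" | "e dvd 1" using irreducibleD by blast
  then show "c dvd 1"
  proof cases
    case 2
    then have "p dvd c" unfolding e by (simp add: mult_unit_dvd_iff)
    with c(2) assms(2) show ?thesis using dvd_trans by blast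
  qed
qed

lemma irreducible_monic_comaximal:
  fixes p q :: "'a::field poly"
  assumes "Factorial_Ring.irreducible p" "Factorial_Ring.irreducible q"
    "Polynomial.lead_coeff p = 1" "Polynomial.lead_coeff q = 1" "p \<noteq> q"
  shows "comaximal p q"
proof (rule irreducible_not_dvd_imp_comaximal[OF assms(1)])
  show "\<not> p dvd q"
  proof
    assume pq: "p dvd q"
    then obtain e where e: "q = p * e" by (elim dvdE)
    have "\<not> p dvd 1" using assms(1) by (simp add: Factorial_Ring.irreducible_def)
    then have "e dvd 1" using assms(2) e irreducibleD by blast
    then have "q dvd p" unfolding e by (simp add: mult_unit_dvd_iff)
    then show False using pq assms monic_dvd_antisym by blast
  qed
qed

text \<open>Suppose \<open>x\<close> is not a unit and its square divides the product. Some
  \<open>P i\<close> divides \<open>x\<close>, since otherwise \<open>x\<close> would be comaximal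
  to a product that it divides. Then the square of \<open>P i\<close> divides the product, and
  cancelling one \<open>P i\<close> contradicts comaximality with the remaining factors.\<close>

lemma squarefree_prod_irreducible:
  fixes P :: "'i \<Rightarrow> 'a::field poly"
  assumes fin: "finite J" and irr: "\<And>i. i \<in> J \<Longrightarrow> Factorial_Ring.irreducible (P i)"
    and com: "\<And>i j. i \<in> J \<Longrightarrow> j \<in> J \<Longrightarrow> i \<noteq> j \<Longrightarrow> comaximal (P i) (P j)"
  shows "squarefree (\<Prod>i\<in>J. P i)"
  unfolding squarefree_def
proof (intro allI impI, rule ccontr)
  fix x assume sq: "x ^ 2 dvd (\<Prod>i\<in>J. P i)" and nu: "\<not> x dvd 1"
  have x: "x dvd (\<Prod>i\<in>J. P i)" using sq by (rule dvd_trans[rotated]) simp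
  have "\<exists>i\<in>J. P i dvd x"
  proof (rule ccontr)
    assume "\<not> (\<exists>i\<in>J. P i dvd x)"
    then have "comaximal x (P i)" if "i \<in> J" for i
      using irreducible_not_dvd_imp_comaximal[OF irr[OF that]] that by (blast intro: comaximal_sym)
    then have "comaximal x (\<Prod>i\<in>J. P i)" by (rule comaximal_prod_right)
    with x nu show False using comaximal_dvd_imp_unit by blast
  qed
  then obtain i where i: "i \<in> J" "P i dvd x" by blast
  have split: "(\<Prod>i\<in>J. P i) = P i * (\<Prod>j\<in>J - {i}. P j)" using fin i by (simp add: prod.remove)
  have "P i * P i dvd x * x" using i by (intro mult_dvd_mono)
  then have "P i * P i dvd (\<Prod>j\<in>J. P j)"
    by (rule dvd_trans[OF _ sq[unfolded power2_eq_square]])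
  then have "P i * P i dvd P i * (\<Prod>j\<in>J - {i}. P j)" unfolding split .
  moreover have "P i \<noteq> 0" "\<not> P i dvd 1" using irr[OF i(1)] by (auto simp: Factorial_Ring.irreducible_def)
  ultimately have "P i dvd (\<Prod>j\<in>J - {i}. P j)" by (simp only: dvd_mult_cancel_left) simp
  moreover have "comaximal (P i) (\<Prod>j\<in>J - {i}. P j)" using i com by (intro comaximal_prod_right) auto
  ultimately show False using \<open>\<not> P i dvd 1\<close> comaximal_dvd_imp_unit by blast
qed

text \<open>The square of a common divisor of \<open>d\<close> and \<open>e\<close> divides
  \<open>d * e\<close>.\<close>

lemma squarefree_mult_imp_comaximal:
  fixes d e :: "'a::field poly"
  assumes "squarefree (d * e)"
  shows "comaximal d e"
proof (rule comaximal_if_common_divisors_units)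
  fix c assume "c dvd d" "c dvd e"
  then have "c ^ 2 dvd d * e" unfolding power2_eq_square by (rule mult_dvd_mono)
  with assms show "c dvd 1" unfolding squarefree_def by blast
qed

subsection \<open>Quotients of the polynomial ring\<close>

text \<open>A presentation of \<open>M\<close> as K[x]/(p): \<open>h\<close> is a surjective ring
  homomorphism with kernel generated by \<open>p\<close>. The spectral algebra, the quotients, their
  product and the subfields of the complex numbers are all handled through this interface.\<close>

locale poly_presentation =
  fixes h :: "'k::field poly \<Rightarrow> 'b" and p :: "'k poly" and M :: "('b, 'm) ring_scheme" (structure)
  assumes carrier_eq: "carrier M = range h"
    and one_eq: "\<one> = h 1"
    and zero_eq: "\<zero> = h 0"
    and add_eq: "h f \<oplus> h g = h (f + g)"
    and mult_eq: "h f \<otimes> h g = h (f * g)"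
    and eq_iff: "h f = h g \<longleftrightarrow> p dvd f - g"
begin

lemma h_closed [simp]: "h f \<in> carrier M"
  by (simp add: carrier_eq)

lemma carrierE:
  assumes "x \<in> carrier M"
  obtains f where "x = h f"
  using assms by (auto simp: carrier_eq)

lemmas h_simps = one_eq zero_eq add_eq mult_eq

lemma cring_M: "cring M"
proof (rule cringI)
  show "abelian_group M"
  proof (rule abelian_groupI)
    fix x assume "x \<in> carrier M"
    then obtain f where f: "x = h f" by (rule carrierE)
    have "h (- f) \<oplus> x = \<zero>" by (simp add: f h_simps)
    then show "\<exists>y\<in>carrier M. y \<oplus> x = \<zero>" by (blast intro: h_closed)
  qed (auto elim!: carrierE simp: h_simps algebra_simps)
  show "comm_monoid M"
    by (rule comm_monoidI) (auto elim!: carrierE simp: h_simps algebra_simps)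
qed (auto elim!: carrierE simp: h_simps algebra_simps)

lemma h_eq_zero_iff: "h f = \<zero> \<longleftrightarrow> p dvd f"
  by (simp add: zero_eq eq_iff)

lemma h_minus: "\<ominus> h f = h (- f)"
proof -
  interpret cring M by (rule cring_M)
  show ?thesis by (rule minus_equality) (simp_all add: h_simps)
qed

text \<open>If \<open>p\<close> does not divide \<open>f\<close>, the coefficient of
  \<open>f\<close> in a Bezout identity for \<open>p\<close> and \<open>f\<close> represents the
  inverse of \<open>h f\<close>.\<close>

lemma field_M:
  assumes "Factorial_Ring.irreducible p"
  shows "field M"
proof (rule cring.cring_fieldI2[OF cring_M])
  have "\<not> p dvd 1" using assms by (simp add: Factorial_Ring.irreducible_def)
  then show "\<zero> \<noteq> \<one>"
    using eq_iff[of 1 0] by (simp add: h_simps)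
next
  fix x assume x: "x \<in> carrier M" "x \<noteq> \<zero>"
  then obtain f where f: "x = h f" by (auto elim: carrierE)
  with x have "\<not> p dvd f" by (simp add: h_eq_zero_iff)
  with assms have "comaximal p f" by (rule irreducible_not_dvd_imp_comaximal)
  then obtain u v where uv: "u * p + v * f = 1" unfolding comaximal_def by blast
  then have "f * v - 1 = p * (- u)" by (simp add: algebra_simps)
  then have "p dvd f * v - 1" by simp
  then have "x \<otimes> h v = \<one>" by (simp add: f h_simps eq_iff)
  then show "\<exists>y\<in>carrier M. x \<otimes> y = \<one>" by (blast intro: h_closed)
qed

text \<open>Reduces left ideals of \<open>M\<close> to ideals of the polynomial ring, which are
  principal.\<close>

lemma poly_ideal_preimage:
  assumes "left_ideal I M"
  shows "poly_ideal {f. h f \<in> I}"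
proof -
  interpret I: additive_subgroup I M using assms by (simp add: left_ideal_def)
  show ?thesis
    using I.zero_closed I.a_closed assms
    by (auto simp: poly_ideal_def left_ideal_def zero_eq simp flip: add_eq mult_eq)
qed

lemma left_ideal_multiples: "left_ideal {h f |f. d dvd f} M"
  unfolding left_ideal_def
proof
  interpret cring M by (rule cring_M)
  have "subgroup {h f |f. d dvd f} (add_monoid M)"
  proof (rule add.subgroupI)
    show "{h f |f. d dvd f} \<noteq> {}" by (auto intro: exI[of _ 0])
  next
    fix a assume "a \<in> {h f |f. d dvd f}"
    then obtain f where f: "a = h f" "d dvd f" by auto
    then have "\<ominus> a = h (- f)" "d dvd - f" by (simp_all add: h_minus)
    then show "\<ominus> a \<in> {h f |f. d dvd f}" by blast
  next
    fix a b assume "a \<in> {h f |f. d dvd f}" "b \<in> {h f |f. d dvd f}"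
    then obtain f g where "a = h f" "d dvd f" "b = h g" "d dvd g" by auto
    then have "a \<oplus> b = h (f + g)" "d dvd f + g" by (simp_all add: h_simps)
    then show "a \<oplus> b \<in> {h f |f. d dvd f}" by blast
  qed auto
  then show "additive_subgroup {h f |f. d dvd f} M" by (rule additive_subgroup.intro)
  show "\<forall>a\<in>{h f |f. d dvd f}. \<forall>r\<in>carrier M. r \<otimes> a \<in> {h f |f. d dvd f}"
  proof (intro ballI)
    fix a r assume "a \<in> {h f |f. d dvd f}" "r \<in> carrier M"
    then obtain f g where "a = h f" "d dvd f" "r = h g" by (auto elim: carrierE)
    then have "r \<otimes> a = h (g * f)" "d dvd g * f" by (simp_all add: h_simps)
    then show "r \<otimes> a \<in> {h f |f. d dvd f}" by blast
  qed
qed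

text \<open>A left ideal is generated by a divisor \<open>d\<close> of \<open>p = d * e\<close>, and since \<open>d\<close> and \<open>e\<close> are
  comaximal, the ideal generated by \<open>e\<close> is a complement.\<close>

lemma semisimple_M:
  assumes "squarefree p"
  shows "semisimple_ring M"
  unfolding semisimple_ring_def
proof (intro conjI allI impI)
  interpret cring M by (rule cring_M)
  show "ring M" by (rule ring_axioms)
  fix I assume I: "left_ideal I M"
  obtain d where d: "\<And>f. h f \<in> I \<longleftrightarrow> d dvd f"
    using poly_ideal_principal[OF poly_ideal_preimage[OF I]] by (metis mem_Collect_eq)
  have sub: "I \<subseteq> carrier M"
    using I additive_subgroup.a_subset unfolding left_ideal_def by blast
  \<comment> \<open>The class of \<open>p\<close> is zero and so lies in \<open>I\<close>, which
    forces the generator \<open>d\<close> of the preimage to divide \<open>p\<close>.\<close>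
  have "h p = h 0" by (simp add: eq_iff)
  also have "h 0 \<in> I" by (simp add: d)
  finally have "d dvd p" by (simp add: d)
  then obtain e where e: "p = d * e" by (elim dvdE)
  have com: "comaximal d e" using assms unfolding e by (rule squarefree_mult_imp_comaximal)
  let ?J = "{h f |f. e dvd f}"
  have "I \<inter> ?J = {\<zero>}"
  proof
    show "I \<inter> ?J \<subseteq> {\<zero>}"
    proof
      fix x assume "x \<in> I \<inter> ?J"
      then obtain f where "x = h f" "d dvd f" "e dvd f" by (auto simp: d)
      then show "x \<in> {\<zero>}"
        using comaximal_mult_dvd[OF com] by (simp add: h_eq_zero_iff e)
    qed
    have "\<zero> \<in> I" by (simp add: zero_eq d)
    moreover have "\<zero> \<in> ?J" using zero_eq by auto
    ultimately show "{\<zero>} \<subseteq> I \<inter> ?J" by simp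
  qed
  moreover have "I <+> ?J = carrier M"
  proof
    show "I <+> ?J \<subseteq> carrier M"
      using sub by (auto simp: set_add_def' intro!: a_closed)
    show "carrier M \<subseteq> I <+> ?J"
    proof
      fix x assume "x \<in> carrier M"
      then obtain f where f: "x = h f" by (rule carrierE)
      obtain u v where uv: "u * d + v * e = 1" using com unfolding comaximal_def by blast
      have "f = f * (u * d + v * e)" by (simp add: uv)
      also have "\<dots> = f * u * d + f * v * e" by (simp add: algebra_simps)
      finally have "x = h (f * u * d) \<oplus> h (f * v * e)" unfolding add_eq f by simp
      moreover have "h (f * u * d) \<in> I" by (simp add: d)
      moreover have "h (f * v * e) \<in> ?J" by (blast intro: dvd_triv_right)
      ultimately show "x \<in> I <+> ?J" unfolding set_add_def' by blast
    qed
  qed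
  ultimately show "\<exists>J. left_ideal J M \<and> I \<inter> J = {\<zero>} \<and> I <+> J = carrier M"
    using left_ideal_multiples[of e] by blast
qed

end

text \<open>Both maps have the kernel generated by \<open>p\<close>, so sending \<open>h f\<close>
  to \<open>h' f\<close> is independent of the representative and injective.\<close>

lemma poly_presentation_ring_iso:
  assumes "poly_presentation h p M" "poly_presentation h' p M'"
  shows "\<exists>\<phi>\<in>ring_iso M M'. \<forall>f. \<phi> (h f) = h' f"
proof -
  interpret M: poly_presentation h p M by fact
  interpret M': poly_presentation h' p M' by fact
  define \<phi> where "\<phi> x = h' (inv_into UNIV h x)" for x
  have \<phi>: "\<phi> (h f) = h' f" for f
  proof -
    have "h (inv_into UNIV h (h f)) = h f" by (rule f_inv_into_f) simp
    then show ?thesis unfolding \<phi>_def M.eq_iff M'.eq_iff .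
  qed
  have "\<phi> \<in> ring_hom M M'"
    by (rule ring_hom_memI) (auto elim!: M.carrierE simp: M.h_simps M'.h_simps \<phi>)
  moreover have "bij_betw \<phi> (carrier M) (carrier M')"
    unfolding bij_betw_def inj_on_def M.carrier_eq M'.carrier_eq image_image
    by (auto simp: \<phi> M.eq_iff M'.eq_iff)
  ultimately show ?thesis using \<phi> unfolding ring_iso_def by blast
qed

locale poly_algebra_presentation = poly_presentation h p M
  for h :: "'k::field poly \<Rightarrow> 'b" and p and M :: "('k, 'b, 'm) module_scheme" (structure) +
  assumes smult_eq: "c \<odot> h f = h (Polynomial.smult c f)"
begin

lemma algebra_M: "Module.algebra (ring_of_type_algebra :: 'k ring) M"
proof (rule algebraI)
  show "cring (ring_of_type_algebra :: 'k ring)" by (rule cring_from_type_algebra)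
  show "cring M" by (rule cring_M)
qed (auto elim!: carrierE
      simp: h_simps smult_eq ring_of_type_algebra_def smult_add_left smult_add_right)

text \<open>The classes of polynomials of degree less than \<open>n\<close> form a subspace of dimension \<open>n\<close> for
  \<open>n \<le> degree p\<close>, which is the whole ring for \<open>n = degree p\<close>.\<close>

lemma finite_dimension_M:
  assumes "p \<noteq> 0"
  shows "ring.finite_dimension M (range (\<lambda>c. c \<odot> \<one>)) (carrier M)"
proof -
  interpret cring M by (rule cring_M)
  let ?K = "range (\<lambda>c. c \<odot> \<one>)"
  let ?E = "\<lambda>n. {h f |f. \<forall>i\<ge>n. Polynomial.coeff f i = 0}"
  have dim: "dimension n ?K (?E n)" if "n \<le> Polynomial.degree p" for n
    using that
  proof (induction n)
    case 0
    have "(\<forall>i\<ge>0. Polynomial.coeff f i = 0) \<longleftrightarrow> f = 0" for f :: "'k poly"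
      by (simp add: poly_eq_iff)
    then have "?E 0 = {\<zero>}" by (simp add: zero_eq)
    then show ?case using zero_dim by simp
  next
    case (Suc n)
    let ?x = "Polynomial.monom 1 n :: 'k poly"
    \<comment> \<open>Equality with a class of lower degree would make \<open>p\<close> divide a
      nonzero polynomial of degree \<open>n\<close>, although \<open>n\<close> is less than the
      degree of \<open>p\<close>.\<close>
    have "h ?x \<notin> ?E n"
    proof
      assume "h ?x \<in> ?E n"
      then obtain f where f: "\<forall>i\<ge>n. Polynomial.coeff f i = 0" and eq: "h ?x = h f" by auto
      have "?x - f \<noteq> 0" using f by (auto simp: poly_eq_iff)
      moreover have "p dvd ?x - f" using eq by (simp add: eq_iff)
      ultimately have "Polynomial.degree p \<le> Polynomial.degree (?x - f)" by (rule dvd_imp_degree_le[rotated])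
      also have "Polynomial.degree (?x - f) \<le> n" using f by (intro degree_le) auto
      finally show False using Suc.prems by simp
    qed
    then have "dimension (Suc n) ?K (line_extension ?K (h ?x) (?E n))"
      using Suc by (intro Suc_dim) auto
    also have "line_extension ?K (h ?x) (?E n) = ?E (Suc n)"
    proof
      show "line_extension ?K (h ?x) (?E n) \<subseteq> ?E (Suc n)"
      proof
        fix y assume "y \<in> line_extension ?K (h ?x) (?E n)"
        then obtain c f where f: "\<forall>i\<ge>n. Polynomial.coeff f i = 0" and y: "y = (c \<odot> \<one>) \<otimes> h ?x \<oplus> h f"
          unfolding line_extension_def set_add_def' r_coset_def by auto
        have "y = h (Polynomial.smult c ?x + f)" by (simp add: y h_simps smult_eq)
        moreover have "\<forall>i\<ge>Suc n. Polynomial.coeff (Polynomial.smult c ?x + f) i = 0" using f by simp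
        ultimately show "y \<in> ?E (Suc n)" by blast
      qed
    next
      show "?E (Suc n) \<subseteq> line_extension ?K (h ?x) (?E n)"
      proof
        fix y assume "y \<in> ?E (Suc n)"
        then obtain f where f: "\<forall>i\<ge>Suc n. Polynomial.coeff f i = 0" and y: "y = h f" by auto
        define c where "c = Polynomial.coeff f n"
        define g where "g = f - Polynomial.smult c ?x"
        have "Polynomial.coeff g i = 0" if "i \<ge> n" for i
          using f that by (cases "i = n") (simp_all add: g_def c_def)
        moreover have "y = (c \<odot> \<one>) \<otimes> h ?x \<oplus> h g" by (simp add: y g_def h_simps smult_eq)
        ultimately show "y \<in> line_extension ?K (h ?x) (?E n)"
          unfolding line_extension_def set_add_def' r_coset_def by auto
      qed
    qed
    finally show ?case .
  qed
  have "?E (Polynomial.degree p) = carrier M"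
  proof
    show "carrier M \<subseteq> ?E (Polynomial.degree p)"
    proof
      fix x assume "x \<in> carrier M"
      then obtain f where f: "x = h f" by (rule carrierE)
      \<comment> \<open>The remainder modulo \<open>p\<close> is a representative of degree below
        that of \<open>p\<close>.\<close>
      have "x = h (f mod p)" by (simp add: f eq_iff minus_mod_eq_mult_div)
      moreover have "Polynomial.coeff (f mod p) i = 0" if "i \<ge> Polynomial.degree p" for i
      proof (cases "f mod p = 0")
        case False
        then have "Polynomial.degree (f mod p) < Polynomial.degree p"
          using assms by (rule degree_mod_less'[rotated])
        then show ?thesis using that by (intro coeff_eq_0) simp
      qed simp
      ultimately show "x \<in> ?E (Polynomial.degree p)" by blast
    qed
  qed auto
  then show ?thesis unfolding finite_dimension_def using dim by fastforce
qed

end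

lemma poly_algebra_presentation_isomorphic:
  fixes M :: "('k::field, 'a, 'n) module_scheme" and M' :: "('k, 'b, 'l) module_scheme"
  assumes "poly_algebra_presentation h p M" "poly_algebra_presentation h' p M'"
  shows "algebra_isomorphic (ring_of_type_algebra :: 'k ring) M M'"
proof -
  interpret M: poly_algebra_presentation h p M by fact
  interpret M': poly_algebra_presentation h' p M' by fact
  obtain \<phi> where "\<phi> \<in> ring_iso M M'" and \<phi>: "\<And>f. \<phi> (h f) = h' f"
    using poly_presentation_ring_iso M.poly_presentation_axioms M'.poly_presentation_axioms by blast
  moreover have "\<forall>c\<in>carrier (ring_of_type_algebra :: 'k ring). \<forall>x\<in>carrier M.
      \<phi> (c \<odot>\<^bsub>M\<^esub> x) = c \<odot>\<^bsub>M'\<^esub> \<phi> x"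
    by (auto elim!: M.carrierE simp: M.smult_eq M'.smult_eq \<phi>)
  ultimately show ?thesis
    unfolding algebra_isomorphic_def using M.algebra_M M'.algebra_M by blast
qed

text \<open>The presentation is the coset map; two cosets agree exactly when the difference lies in
  the principal ideal, that is, is divisible by \<open>p\<close>.\<close>

lemma poly_quotient_presentation:
  fixes p :: "'k::field poly"
  defines "P \<equiv> (ring_of_type_algebra :: 'k poly ring)"
  shows "poly_algebra_presentation (\<lambda>f. (PIdl\<^bsub>P\<^esub> p) +>\<^bsub>P\<^esub> f) p (poly_quotient p)"
proof -
  interpret P: cring P unfolding P_def by (rule cring_from_type_algebra)
  define I where "I = PIdl\<^bsub>P\<^esub> p"
  have carrier_P: "carrier P = UNIV" and ops: "f \<otimes>\<^bsub>P\<^esub> g = f * g" "f \<oplus>\<^bsub>P\<^esub> g = f + g" "\<one>\<^bsub>P\<^esub> = 1" "\<zero>\<^bsub>P\<^esub> = 0" for f g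
    by (simp_all add: P_def ring_of_type_algebra_def)
  interpret I: ideal I P unfolding I_def by (rule P.cgenideal_ideal) (simp add: carrier_P)
  have minus: "f \<ominus>\<^bsub>P\<^esub> g = f - g" for f g
  proof -
    have "\<ominus>\<^bsub>P\<^esub> g = - g" by (rule P.minus_equality) (simp_all add: ops carrier_P)
    then show ?thesis by (simp add: a_minus_def ops)
  qed
  have I_iff: "f \<in> I \<longleftrightarrow> p dvd f" for f
    by (auto simp: I_def cgenideal_def carrier_P ops dvd_def mult.commute)
  have q: "poly_quotient p = (let Q = P Quot I in
     \<lparr> carrier = carrier Q, monoid.mult = monoid.mult Q, one = one Q, zero = zero Q, add = add Q,
       module.smult = (\<lambda>c u. (I +>\<^bsub>P\<^esub> [:c:]) \<otimes>\<^bsub>Q\<^esub> u) \<rparr>)"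
    unfolding poly_quotient_def I_def P_def by (simp add: Let_def)
  have hom: "(+>\<^bsub>P\<^esub>) I \<in> ring_hom P (P Quot I)" by (rule I.rcos_ring_hom)
  note homs = ring_hom_mult[OF hom, symmetric] ring_hom_add[OF hom, symmetric] ring_hom_one[OF hom, symmetric]
  have "poly_algebra_presentation (\<lambda>f. I +>\<^bsub>P\<^esub> f) p (poly_quotient p)"
  proof
    show "carrier (poly_quotient p) = range (\<lambda>f. I +>\<^bsub>P\<^esub> f)"
      by (auto simp: q Let_def FactRing_def A_RCOSETS_def' carrier_P)
    show "\<one>\<^bsub>poly_quotient p\<^esub> = I +>\<^bsub>P\<^esub> 1"
      using homs(3) by (simp add: q Let_def ops)
    show "\<zero>\<^bsub>poly_quotient p\<^esub> = I +>\<^bsub>P\<^esub> 0"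
      using ring_hom_zero[OF hom P.ring_axioms I.quotient_is_ring] by (simp add: q Let_def ops)
    show "(I +>\<^bsub>P\<^esub> f) \<oplus>\<^bsub>poly_quotient p\<^esub> (I +>\<^bsub>P\<^esub> g) = I +>\<^bsub>P\<^esub> (f + g)" for f g
      using homs(2)[of f g] by (simp add: q Let_def ops carrier_P)
    show "(I +>\<^bsub>P\<^esub> f) \<otimes>\<^bsub>poly_quotient p\<^esub> (I +>\<^bsub>P\<^esub> g) = I +>\<^bsub>P\<^esub> (f * g)" for f g
      using homs(1)[of f g] by (simp add: q Let_def ops carrier_P)
    show "c \<odot>\<^bsub>poly_quotient p\<^esub> (I +>\<^bsub>P\<^esub> f) = I +>\<^bsub>P\<^esub> Polynomial.smult c f" for c f
      using homs(1)[of "[:c:]" f] by (simp add: q Let_def ops carrier_P)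
    show "I +>\<^bsub>P\<^esub> f = I +>\<^bsub>P\<^esub> g \<longleftrightarrow> p dvd f - g" for f g
      using P.quotient_eq_iff_same_a_r_cos[OF I.ideal_axioms, of f g]
      by (simp add: carrier_P minus I_iff)
  qed
  then show ?thesis by (simp add: I_def)
qed

text \<open>Surjectivity onto the product is the Chinese remainder theorem, and the kernel is found
  from \<open>comaximal_prod_dvd_iff\<close>.\<close>

lemma product_algebra_presentation:
  fixes P :: "'i \<Rightarrow> 'k::field poly"
  assumes fin: "finite J"
    and com: "\<And>i j. i \<in> J \<Longrightarrow> j \<in> J \<Longrightarrow> i \<noteq> j \<Longrightarrow> comaximal (P i) (P j)"
    and pres: "\<And>i. i \<in> J \<Longrightarrow> poly_algebra_presentation (h i) (P i) (M i)"
  shows "poly_algebra_presentation (\<lambda>f. \<lambda>i\<in>J. h i f) (\<Prod>i\<in>J. P i) (product_algebra J M)"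
proof
  have pres': "poly_presentation (h i) (P i) (M i)" if "i \<in> J" for i
    using pres[OF that] by (simp add: poly_algebra_presentation_def)
  note car = poly_presentation.carrier_eq[OF pres']
  show "carrier (product_algebra J M) = range (\<lambda>f. \<lambda>i\<in>J. h i f)"
  proof
    show "range (\<lambda>f. \<lambda>i\<in>J. h i f) \<subseteq> carrier (product_algebra J M)"
      using pres' by (auto simp: product_algebra_def car)
  next
    show "carrier (product_algebra J M) \<subseteq> range (\<lambda>f. \<lambda>i\<in>J. h i f)"
    proof
      fix x assume "x \<in> carrier (product_algebra J M)"
      moreover have "(\<Pi>\<^sub>E i\<in>J. carrier (M i)) = (\<Pi>\<^sub>E i\<in>J. range (h i))"
        by (rule PiE_cong) (rule car)
      ultimately have x: "x \<in> (\<Pi>\<^sub>E i\<in>J. range (h i))"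
        by (simp add: product_algebra_def)
      then have "\<forall>i\<in>J. \<exists>f. x i = h i f" by (auto simp: PiE_iff)
      then obtain r where r: "\<And>i. i \<in> J \<Longrightarrow> x i = h i (r i)" by metis
      obtain f where f: "\<forall>i\<in>J. P i dvd f - r i" using chinese_remainder[of J P r] fin com by blast
      have "x = (\<lambda>i\<in>J. h i f)"
      proof (rule PiE_ext[OF x])
        show "(\<lambda>i\<in>J. h i f) \<in> (\<Pi>\<^sub>E i\<in>J. range (h i))" by auto
        fix i assume i: "i \<in> J"
        then have "h i f = h i (r i)"
          using pres'[OF i] f by (simp add: poly_presentation.eq_iff)
        then show "x i = (\<lambda>i\<in>J. h i f) i" using r i by simp
      qed
      then show "x \<in> range (\<lambda>f. \<lambda>i\<in>J. h i f)" by blast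
    qed
  qed
  show "(\<lambda>i\<in>J. h i f) = (\<lambda>i\<in>J. h i g) \<longleftrightarrow> (\<Prod>i\<in>J. P i) dvd f - g" for f g
  proof -
    have "(\<lambda>i\<in>J. h i f) = (\<lambda>i\<in>J. h i g) \<longleftrightarrow> (\<forall>i\<in>J. h i f = h i g)"
      by (auto simp: fun_eq_iff)
    also have "\<dots> \<longleftrightarrow> (\<forall>i\<in>J. P i dvd f - g)"
      by (intro ball_cong refl poly_presentation.eq_iff[OF pres'])
    also have "\<dots> \<longleftrightarrow> (\<Prod>i\<in>J. P i) dvd f - g"
      by (rule comaximal_prod_dvd_iff[symmetric]) (use fin com in auto)
    finally show ?thesis .
  qed
  show "\<one>\<^bsub>product_algebra J M\<^esub> = (\<lambda>i\<in>J. h i 1)"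
    by (auto simp: product_algebra_def intro!: restrict_ext poly_presentation.one_eq[OF pres'])
  show "\<zero>\<^bsub>product_algebra J M\<^esub> = (\<lambda>i\<in>J. h i 0)"
    by (auto simp: product_algebra_def intro!: restrict_ext poly_presentation.zero_eq[OF pres'])
  show "(\<lambda>i\<in>J. h i f) \<oplus>\<^bsub>product_algebra J M\<^esub> (\<lambda>i\<in>J. h i g) = (\<lambda>i\<in>J. h i (f + g))" for f g
    by (auto simp: product_algebra_def poly_presentation.add_eq[OF pres'] intro!: restrict_ext)
  show "(\<lambda>i\<in>J. h i f) \<otimes>\<^bsub>product_algebra J M\<^esub> (\<lambda>i\<in>J. h i g) = (\<lambda>i\<in>J. h i (f * g))" for f g
    by (auto simp: product_algebra_def poly_presentation.mult_eq[OF pres'] intro!: restrict_ext)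
  show "c \<odot>\<^bsub>product_algebra J M\<^esub> (\<lambda>i\<in>J. h i f) = (\<lambda>i\<in>J. h i (Polynomial.smult c f))" for c f
    by (auto simp: product_algebra_def poly_algebra_presentation.smult_eq[OF pres] intro!: restrict_ext)
qed

subsection \<open>Conjugate elements of the algebraic closure\<close>

text \<open>Covers both embeddings that occur: \<open>to_ac\<close> into the algebraic closure and
  \<open>of_rat\<close> into the complex numbers.\<close>

locale field_embedding =
  fixes e :: "'k::field \<Rightarrow> 'l::field"
  assumes hom_1 [simp]: "e 1 = 1"
    and hom_add [simp]: "e (a + b) = e a + e b"
    and hom_mult [simp]: "e (a * b) = e a * e b"
begin

lemma hom_0 [simp]: "e 0 = 0"
proof -
  have "e 0 + e 0 = e 0 + 0" by (simp flip: hom_add)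
  then show ?thesis by (rule add_left_imp_eq)
qed

lemma hom_sum: "e (\<Sum>i\<in>A. f i) = (\<Sum>i\<in>A. e (f i))"
  by (induction A rule: infinite_finite_induct) simp_all

lemma hom_eq_0_iff [simp]: "e a = 0 \<longleftrightarrow> a = 0"
proof
  assume "e a = 0"
  then have "e (a * inverse a) = 0" by simp
  then show "a = 0" by (cases "a = 0") (simp_all del: hom_mult)
qed simp

abbreviation ev :: "'k poly \<Rightarrow> 'l \<Rightarrow> 'l" where
  "ev f x \<equiv> poly (map_poly e f) x"

lemma ev_pCons [simp]: "ev (pCons c f) x = e c + x * ev f x"
  by (simp add: map_poly_pCons)

lemma ev_1 [simp]: "ev 1 x = 1"
  by (simp add: one_pCons)

lemma ev_add [simp]: "ev (f + g) x = ev f x + ev g x"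
proof -
  have "map_poly e (f + g) = map_poly e f + map_poly e g"
    by (rule poly_eqI) (simp add: coeff_map_poly)
  then show ?thesis by simp
qed

lemma ev_smult [simp]: "ev (Polynomial.smult c f) x = e c * ev f x"
proof -
  have "map_poly e (Polynomial.smult c f) = Polynomial.smult (e c) (map_poly e f)"
    by (rule poly_eqI) (simp add: coeff_map_poly)
  then show ?thesis by simp
qed

lemma ev_mult [simp]: "ev (f * g) x = ev f x * ev g x"
  by (induction f) (simp_all add: algebra_simps)

lemma ev_diff [simp]: "ev (f - g) x = ev f x - ev g x"
  using ev_add[of "f - g" g x] by (simp del: ev_add)

lemma ev_eq_0_if_dvd: "p dvd f \<Longrightarrow> ev p x = 0 \<Longrightarrow> ev f x = 0"
  by (auto elim!: dvdE)

lemma poly_ideal_ev: "poly_ideal {f. ev f x = 0}"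
  by (auto simp: poly_ideal_def)

text \<open>If \<open>p\<close> did not divide \<open>f\<close>, evaluating a Bezout identity for
  \<open>p\<close> and \<open>f\<close> at the common root \<open>x\<close> would give 0 =
  1.\<close>

lemma irreducible_root_iff:
  assumes "Factorial_Ring.irreducible p" "ev p x = 0"
  shows "ev f x = 0 \<longleftrightarrow> p dvd f"
proof
  assume f: "ev f x = 0"
  show "p dvd f"
  proof (rule ccontr)
    assume "\<not> p dvd f"
    then obtain u v where "u * p + v * f = 1"
      using irreducible_not_dvd_imp_comaximal[OF assms(1)] unfolding comaximal_def by blast
    then have "ev (u * p + v * f) x = 1" by (simp only: ev_1)
    then show False using f assms(2) by simp
  qed
qed (use assms ev_eq_0_if_dvd in blast)

end

section \<open>Minimal polynomials over the base field\<close>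

interpretation to_ac: field_embedding to_ac
  by unfold_locales simp_all

text \<open>Every element of the closure is algebraic, so its vanishing ideal is nonzero and the
  definite description is justified.\<close>

lemma min_poly_over_aux:
  fixes x :: "'k::field alg_closure"
  shows "Polynomial.lead_coeff (min_poly_over x) = 1 \<and> to_ac.ev (min_poly_over x) x = 0 \<and>
     (\<forall>q. to_ac.ev q x = 0 \<longrightarrow> min_poly_over x dvd q)"
proof -
  obtain p :: "'k poly" where "p \<noteq> 0" "to_ac.ev p x = 0"
    using alg_closure_algebraic[of x] by blast
  then have "\<exists>!d. Polynomial.lead_coeff d = 1 \<and> d \<in> {f. to_ac.ev f x = 0} \<and>
      (\<forall>f. f \<in> {f. to_ac.ev f x = 0} \<longrightarrow> d dvd f)"
    by (intro poly_ideal_monic_generator[OF to_ac.poly_ideal_ev]) auto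
  then have "\<exists>!p. Polynomial.lead_coeff p = 1 \<and> to_ac.ev p x = 0 \<and> (\<forall>q. to_ac.ev q x = 0 \<longrightarrow> p dvd q)"
    by simp
  then show ?thesis unfolding min_poly_over_def by (rule theI')
qed

lemma lead_coeff_min_poly_over: "Polynomial.lead_coeff (min_poly_over x) = 1"
  using min_poly_over_aux by blast

lemma min_poly_over_dvd_iff: "min_poly_over x dvd q \<longleftrightarrow> to_ac.ev q x = 0"
  using min_poly_over_aux to_ac.ev_eq_0_if_dvd by blast

text \<open>In a factorization one factor vanishes at \<open>x\<close>, is therefore a multiple of
  the minimal polynomial, and leaves a unit as the other factor.\<close>

lemma irreducible_min_poly_over: "Factorial_Ring.irreducible (min_poly_over (x :: 'k::field alg_closure))"
proof (rule Factorial_Ring.irreducibleI)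
  show "min_poly_over x \<noteq> 0" using lead_coeff_min_poly_over[of x] by auto
  then have nz: "min_poly_over x \<noteq> 0" .
  show "\<not> min_poly_over x dvd 1" by (simp add: min_poly_over_dvd_iff)
  fix a b assume ab: "min_poly_over x = a * b"
  have "to_ac.ev (a * b) x = 0" by (simp flip: ab min_poly_over_dvd_iff)
  then consider "to_ac.ev a x = 0" | "to_ac.ev b x = 0" by auto
  then show "a dvd 1 \<or> b dvd 1"
  proof cases
    case 1
    then have "a * b dvd a * 1" by (simp flip: ab min_poly_over_dvd_iff)
    then have "b dvd 1" using nz unfolding ab by (subst (asm) dvd_mult_cancel_left) auto
    then show ?thesis ..
  next
    case 2
    then have "a * b dvd 1 * b" by (simp flip: ab min_poly_over_dvd_iff)
    then have "a dvd 1" using nz unfolding ab by (subst (asm) dvd_mult_cancel_right) auto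
    then show ?thesis ..
  qed
qed

lemma min_poly_over_eqI:
  assumes "\<And>f. to_ac.ev f x = 0 \<longleftrightarrow> to_ac.ev f y = 0"
  shows "min_poly_over x = min_poly_over y"
proof -
  have "min_poly_over x dvd f \<longleftrightarrow> min_poly_over y dvd f" for f
    using assms by (simp add: min_poly_over_dvd_iff)
  from this[of "min_poly_over x"] this[of "min_poly_over y"] show ?thesis
    by (intro monic_dvd_antisym lead_coeff_min_poly_over) simp_all
qed

text \<open>Graphs of \<open>K\<close>-embeddings of intermediate rings into the algebraic closure. The
  condition on pairs \<open>(0, y)\<close> makes the relation single valued.\<close>

definition partial_embedding :: "('k::field alg_closure \<times> 'k alg_closure) set \<Rightarrow> bool" where
  "partial_embedding R \<longleftrightarrow> (\<forall>c. (to_ac c, to_ac c) \<in> R) \<and>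
     (\<forall>x y x' y'. (x, y) \<in> R \<longrightarrow> (x', y') \<in> R \<longrightarrow> (x + x', y + y') \<in> R \<and> (x * x', y * y') \<in> R) \<and>
     (\<forall>y. (0, y) \<in> R \<longrightarrow> y = 0)"

context
  fixes R :: "('k::field alg_closure \<times> 'k alg_closure) set"
  assumes R: "partial_embedding R"
begin

lemma partial_embedding_const: "(to_ac c, to_ac c) \<in> R"
  and partial_embedding_add: "(x, y) \<in> R \<Longrightarrow> (x', y') \<in> R \<Longrightarrow> (x + x', y + y') \<in> R"
  and partial_embedding_mult: "(x, y) \<in> R \<Longrightarrow> (x', y') \<in> R \<Longrightarrow> (x * x', y * y') \<in> R"
  and partial_embedding_0: "(0, y) \<in> R \<Longrightarrow> y = 0"
  using R unfolding partial_embedding_def by blast+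

lemma partial_embedding_00: "(0, 0) \<in> R"
  and partial_embedding_11: "(1, 1) \<in> R"
  using partial_embedding_const[of 0] partial_embedding_const[of 1] by simp_all

lemma partial_embedding_diff:
  assumes "(x, y) \<in> R" "(x', y') \<in> R"
  shows "(x - x', y - y') \<in> R"
  using partial_embedding_add[OF assms(1) partial_embedding_mult[OF partial_embedding_const[of "-1"] assms(2)]]
  by simp

lemma partial_embedding_single_valued:
  assumes "(x, y) \<in> R" "(x, y') \<in> R"
  shows "y = y'"
  using partial_embedding_0[of "y - y'"] partial_embedding_diff[OF assms] by simp

lemma partial_embedding_sum:
  assumes "\<And>i. i \<in> A \<Longrightarrow> (f i, g i) \<in> R"
  shows "((\<Sum>i\<in>A. f i), (\<Sum>i\<in>A. g i)) \<in> R"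
  using assms
  by (induction A rule: infinite_finite_induct)
    (auto intro: partial_embedding_add partial_embedding_00)

lemma partial_embedding_ev:
  assumes "(x, y) \<in> R"
  shows "(to_ac.ev f x, to_ac.ev f y) \<in> R"
  by (induction f)
    (simp_all add: partial_embedding_00 partial_embedding_add partial_embedding_mult
      partial_embedding_const assms)

text \<open>An algebraic \<open>x \<noteq> 0\<close> has an inverse in \<open>K[x]\<close>, which must be mapped to an inverse of
  the image of \<open>x\<close>.\<close>

lemma partial_embedding_inj_0:
  assumes "(x, 0) \<in> R"
  shows "x = 0"
proof (rule ccontr)
  assume "x \<noteq> 0"
  then have "\<not> min_poly_over x dvd [:0, 1:]" by (simp add: min_poly_over_dvd_iff)
  then obtain u v where uv: "u * min_poly_over x + v * [:0, 1:] = 1"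
    using irreducible_not_dvd_imp_comaximal[OF irreducible_min_poly_over] unfolding comaximal_def by blast
  have "to_ac.ev (u * min_poly_over x + v * [:0, 1:]) x = 1" unfolding uv by simp
  moreover have "to_ac.ev (min_poly_over x) x = 0" by (simp flip: min_poly_over_dvd_iff)
  ultimately have "to_ac.ev v x * x = 1" by (simp add: mult.commute)
  with partial_embedding_mult[OF partial_embedding_ev[OF assms, of v] assms] have "(1, 0) \<in> R" by simp
  from partial_embedding_single_valued[OF this partial_embedding_11] show False by simp
qed

text \<open>This symmetry lets one extension lemma enlarge both the domain and the range.\<close>

lemma partial_embedding_converse: "partial_embedding (R\<inverse>)"
  using R partial_embedding_inj_0 unfolding partial_embedding_def by auto

text \<open>\<open>q\<close> arises from \<open>p\<close> by applying the embedding with graph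
  \<open>R\<close> to every coefficient.\<close>

definition related_polys :: "'k alg_closure poly \<Rightarrow> 'k alg_closure poly \<Rightarrow> bool" where
  "related_polys p q \<longleftrightarrow> (\<forall>i. (Polynomial.coeff p i, Polynomial.coeff q i) \<in> R)"

text \<open>The relation is single valued and injective at 0, so corresponding coefficients vanish
  together.\<close>

lemma related_polys_degree:
  assumes "related_polys p q"
  shows "Polynomial.degree p = Polynomial.degree q"
proof -
  have "Polynomial.coeff p i = 0 \<longleftrightarrow> Polynomial.coeff q i = 0" for i
    using assms partial_embedding_0 partial_embedding_inj_0 unfolding related_polys_def by metis
  then show ?thesis by (simp add: Polynomial.degree_def)
qed

lemma related_polys_mult:
  assumes "related_polys p q" "related_polys p' q'"
  shows "related_polys (p * p') (q * q')"
  using assms unfolding related_polys_def coeff_mult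
  by (auto intro: partial_embedding_sum partial_embedding_mult)

text \<open>Division with remainder by a polynomial of least degree, carried out on both components
  at once, shows that the images of polynomials vanishing at \<open>x\<close> vanish at \<open>y\<close>.\<close>

lemma related_polys_root:
  assumes m: "related_polys m m'" "m \<noteq> 0" "poly m x = 0" "poly m' y = 0"
    and least: "\<And>p q. related_polys p q \<Longrightarrow> p \<noteq> 0 \<Longrightarrow> poly p x = 0 \<Longrightarrow> Polynomial.degree m \<le> Polynomial.degree p"
    and "related_polys p q" "poly p x = 0"
  shows "poly q y = 0"
  using assms(6,7)
proof (induction "Polynomial.degree p" arbitrary: p q rule: less_induct)
  case less
  show ?case
  proof (cases "p = 0")
    case True
    then have "q = 0" using less.prems(1) partial_embedding_0 by (simp add: related_polys_def poly_eq_iff)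
    then show ?thesis by simp
  next
    case False
    have le: "Polynomial.degree m \<le> Polynomial.degree p" using least less.prems False by blast
    define k where "k = Polynomial.degree p - Polynomial.degree m"
    have dp: "Polynomial.degree p = k + Polynomial.degree m" using le by (simp add: k_def)
    have pos: "Polynomial.degree p > 0"
    proof (rule ccontr)
      assume "\<not> Polynomial.degree p > 0"
      then obtain c where "p = [:c:]" using degree_eq_zeroE by blast
      then show False using False less.prems(2) by simp
    qed
    define a where "a = Polynomial.lead_coeff m"
    define a' where "a' = Polynomial.lead_coeff m'"
    define b where "b = Polynomial.lead_coeff p"
    define b' where "b' = Polynomial.lead_coeff q"
    have a: "(a, a') \<in> R" and b: "(b, b') \<in> R"
      using m(1) less.prems(1) related_polys_degree[OF m(1)] related_polys_degree[OF less.prems(1)]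
      unfolding a_def a'_def b_def b'_def related_polys_def by simp_all
    \<comment> \<open>Pseudo-division: the domain of \<open>R\<close> is only known to be a ring, so
      the leading terms are cancelled by cross-multiplication instead of dividing by
      \<open>a\<close>.\<close>
    define p1 where "p1 = Polynomial.smult a p - Polynomial.smult b (Polynomial.monom 1 k * m)"
    define q1 where "q1 = Polynomial.smult a' q - Polynomial.smult b' (Polynomial.monom 1 k * m')"
    have "related_polys p1 q1"
      using m(1) less.prems(1) unfolding related_polys_def p1_def q1_def
      by (auto simp: coeff_monom_mult intro!: partial_embedding_diff partial_embedding_mult[OF a] partial_embedding_mult[OF b] partial_embedding_00)
    moreover have "Polynomial.degree p1 < Polynomial.degree p"
    proof -
      have "Polynomial.coeff p1 i = 0" if "i > Polynomial.degree p - 1" for i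
      proof (cases "i = Polynomial.degree p")
        case True
        then show ?thesis by (simp add: p1_def coeff_monom_mult a_def b_def dp)
      next
        case False
        then have i: "i > Polynomial.degree p" using that by simp
        then have "i - k > Polynomial.degree m" using dp by simp
        then show ?thesis using i by (simp add: p1_def coeff_monom_mult coeff_eq_0)
      qed
      then have "Polynomial.degree p1 \<le> Polynomial.degree p - 1" by (intro degree_le) auto
      then show ?thesis using pos by simp
    qed
    moreover have "poly p1 x = 0" using m less.prems by (simp add: p1_def)
    ultimately have "poly q1 y = 0" using less.hyps by blast
    then have "a' * poly q y = 0" using m by (simp add: q1_def)
    moreover have "a' \<noteq> 0"
      using m(2) a partial_embedding_inj_0[of a] by (auto simp: a_def)
    ultimately show ?thesis by simp
  qed
qed

text \<open>Take \<open>m\<close> of least degree among the nonzero polynomials over the domain of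
  \<open>R\<close> that vanish at \<open>x\<close>, and let \<open>y\<close> be any root of its
  image \<open>m'\<close>. Relating \<open>poly p x\<close> to \<open>poly q y\<close> for all
  related \<open>p\<close> and \<open>q\<close> is single valued by
  \<open>related_polys_root\<close>.\<close>

lemma partial_embedding_extend:
  "\<exists>R' y. partial_embedding R' \<and> R \<subseteq> R' \<and> (x, y) \<in> R'"
proof -
  define P where "P mm \<longleftrightarrow> related_polys (fst mm) (snd mm) \<and> fst mm \<noteq> 0 \<and> poly (fst mm) x = 0" for mm
  obtain f :: "'k poly" where f: "f \<noteq> 0" "to_ac.ev f x = 0"
    using alg_closure_algebraic[of x] by blast
  have "P (map_poly to_ac f, map_poly to_ac f)"
    using f by (auto simp: P_def related_polys_def coeff_map_poly partial_embedding_const map_poly_eq_0_iff)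
  then obtain mm where mm: "P mm" and least: "\<And>z. P z \<Longrightarrow> Polynomial.degree (fst mm) \<le> Polynomial.degree (fst z)"
    using ex_has_least_nat[of P _ "\<lambda>z. Polynomial.degree (fst z)"] by blast
  obtain m m' where [simp]: "mm = (m, m')" by (cases mm)
  have m: "related_polys m m'" "m \<noteq> 0" "poly m x = 0" using mm by (simp_all add: P_def)
  have least: "Polynomial.degree m \<le> Polynomial.degree p"
    if "related_polys p q" "p \<noteq> 0" "poly p x = 0" for p q
    using least[of "(p, q)"] that by (simp add: P_def)
  \<comment> \<open>A nonzero constant has no root. Since \<open>m'\<close> has the same degree,
    algebraic closedness supplies \<open>y\<close>.\<close>
  have "Polynomial.degree m > 0"
  proof (rule ccontr)
    assume "\<not> Polynomial.degree m > 0"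
    then obtain c where "m = [:c:]" using degree_eq_zeroE by blast
    then show False using m by simp
  qed
  then have "Polynomial.degree m' > 0" using related_polys_degree[OF m(1)] by simp
  then obtain y where y: "poly m' y = 0" using alg_closed_imp_poly_has_root by blast
  have root: "poly q y = 0" if "related_polys p q" "poly p x = 0" for p q
    using related_polys_root[OF m y least that] .
  define R' where "R' = {(poly p x, poly q y) |p q. related_polys p q}"
  have "R \<subseteq> R'"
  proof (rule subrelI)
    fix a b assume ab: "(a, b) \<in> R"
    have "related_polys [:a:] [:b:]"
      unfolding related_polys_def using ab partial_embedding_00 by (auto simp: coeff_pCons split: nat.split)
    then have "(poly [:a:] x, poly [:b:] y) \<in> R'" unfolding R'_def by blast
    then show "(a, b) \<in> R'" by simp
  qed
  moreover have "(x, y) \<in> R'"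
  proof -
    have "related_polys [:0, 1:] [:0, 1:]"
      unfolding related_polys_def using partial_embedding_00 partial_embedding_11
      by (auto simp: coeff_pCons split: nat.split)
    then have "(poly [:0, 1:] x, poly [:0, 1:] y) \<in> R'" unfolding R'_def by blast
    then show ?thesis by simp
  qed
  moreover have "partial_embedding R'"
    unfolding partial_embedding_def
  proof (intro conjI allI impI)
    fix c show "(to_ac c, to_ac c) \<in> R'" using \<open>R \<subseteq> R'\<close> partial_embedding_const by blast
  next
    fix a b a' b' assume "(a, b) \<in> R'" "(a', b') \<in> R'"
    then obtain p q p' q' where *: "related_polys p q" "related_polys p' q'"
      and [simp]: "a = poly p x" "b = poly q y" "a' = poly p' x" "b' = poly q' y"
      unfolding R'_def by blast
    have "related_polys (p + p') (q + q')"
      using * unfolding related_polys_def by (auto intro: partial_embedding_add)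
    then have "(poly (p + p') x, poly (q + q') y) \<in> R'" unfolding R'_def by blast
    then show "(a + a', b + b') \<in> R'" by simp
    have "(poly (p * p') x, poly (q * q') y) \<in> R'"
      unfolding R'_def using related_polys_mult[OF *] by blast
    then show "(a * a', b * b') \<in> R'" by simp
  next
    fix z assume "(0, z) \<in> R'"
    then obtain p q where "related_polys p q" "poly p x = 0" "z = poly q y"
      unfolding R'_def by auto
    then show "z = 0" using root by blast
  qed
  ultimately show ?thesis by blast
qed

end

lemma partial_embedding_Union:
  assumes "C \<noteq> {}" "subset.chain {R. partial_embedding R} C"
  shows "partial_embedding (\<Union>C)"
  unfolding partial_embedding_def
proof (intro conjI allI impI)
  fix c show "(to_ac c, to_ac c) \<in> \<Union>C"
    using assms partial_embedding_const by (fastforce simp: subset.chain_def)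
next
  have C: "\<And>R. R \<in> C \<Longrightarrow> partial_embedding R"
    and chain: "\<And>R R'. R \<in> C \<Longrightarrow> R' \<in> C \<Longrightarrow> R \<subseteq> R' \<or> R' \<subseteq> R"
    using assms(2) by (auto simp: subset.chain_def)
  fix x y x' y' assume "(x, y) \<in> \<Union>C" "(x', y') \<in> \<Union>C"
  then obtain R R' where "R \<in> C" "(x, y) \<in> R" "R' \<in> C" "(x', y') \<in> R'" by blast
  then obtain R'' where R'': "R'' \<in> C" "(x, y) \<in> R''" "(x', y') \<in> R''" using chain by blast
  show "(x + x', y + y') \<in> \<Union>C"
    using partial_embedding_add[OF C[OF R''(1)] R''(2,3)] R''(1) by blast
  show "(x * x', y * y') \<in> \<Union>C"
    using partial_embedding_mult[OF C[OF R''(1)] R''(2,3)] R''(1) by blast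
next
  fix y assume "(0, y) \<in> \<Union>C"
  then show "y = 0" using assms(2) partial_embedding_0 by (auto simp: subset.chain_def)
qed

text \<open>By Zorn's lemma there is a maximal embedding above \<open>R0\<close>. Extending it shows
  that it is defined everywhere, and extending its converse shows that it is surjective.\<close>

lemma partial_embedding_extends_to_automorphism:
  assumes R0: "partial_embedding R0"
  shows "\<exists>\<sigma>\<in>carrier galois_group. \<forall>(x, y)\<in>R0. \<sigma> x = y"
proof -
  let ?A = "{R. partial_embedding R \<and> R0 \<subseteq> R}"
  have "\<exists>R\<in>?A. \<forall>R'\<in>?A. R \<subseteq> R' \<longrightarrow> R' = R"
  proof (rule subset_Zorn_nonempty)
    show "?A \<noteq> {}" using R0 by blast
    fix C assume C: "C \<noteq> {}" "subset.chain ?A C"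
    then have "subset.chain {R. partial_embedding R} C" by (auto simp: subset.chain_def)
    moreover have "R0 \<subseteq> \<Union>C" using C unfolding subset.chain_def by blast
    ultimately show "\<Union>C \<in> ?A" using partial_embedding_Union[OF C(1)] by simp
  qed
  then obtain R where "R \<in> ?A" and maximal: "\<forall>R'\<in>?A. R \<subseteq> R' \<longrightarrow> R' = R" by (rule bexE)
  then have R: "partial_embedding R" "R0 \<subseteq> R" by simp_all
  have max: "R' = R" if "partial_embedding R'" "R \<subseteq> R'" for R'
    using bspec[OF maximal, of R'] that order_trans[OF R(2) that(2)] by simp
  have dom: "\<exists>y. (x, y) \<in> R" for x
  proof -
    obtain R' y where "partial_embedding R'" "R \<subseteq> R'" "(x, y) \<in> R'"
      using partial_embedding_extend[OF R(1)] by blast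
    then show ?thesis using max[of R'] by auto
  qed
  have ran: "\<exists>x. (x, y) \<in> R" for y
  proof -
    obtain R' x where R': "partial_embedding R'" "R\<inverse> \<subseteq> R'" "(y, x) \<in> R'"
      using partial_embedding_extend[OF partial_embedding_converse[OF R(1)]] by blast
    \<comment> \<open>The converse of an extension of the converse of \<open>R\<close> is a partial
      embedding containing \<open>R\<close>, so maximality applies.\<close>
    then have "R'\<inverse> = R" by (intro max partial_embedding_converse) auto
    then show ?thesis using R'(3) by blast
  qed
  define \<sigma> where "\<sigma> x = (SOME y. (x, y) \<in> R)" for x
  have \<sigma>R: "(x, \<sigma> x) \<in> R" for x unfolding \<sigma>_def using dom by (rule someI_ex)
  have \<sigma>: "\<sigma> x = y" if "(x, y) \<in> R" for x y
    using partial_embedding_single_valued[OF R(1) \<sigma>R that] .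
  have inj: "inj \<sigma>"
  proof (rule injI)
    fix x y assume "\<sigma> x = \<sigma> y"
    then have "(x, \<sigma> x) \<in> R" "(y, \<sigma> x) \<in> R" using \<sigma>R[of x] \<sigma>R[of y] by simp_all
    then show "x = y"
      by (intro partial_embedding_single_valued[OF partial_embedding_converse[OF R(1)]]) auto
  qed
  have "surj \<sigma>" unfolding surj_def using ran \<sigma>[symmetric] by blast
  then have "\<sigma> \<in> ring_iso ring_of_type_algebra ring_of_type_algebra"
    using inj unfolding ring_iso_def ring_of_type_algebra_def
    by (auto intro!: ring_hom_memI \<sigma> partial_embedding_add partial_embedding_mult partial_embedding_11 R \<sigma>R
        simp: bij_def)
  then have "\<sigma> \<in> carrier galois_group"
    using \<sigma> partial_embedding_const[OF R(1)] by (simp add: galois_group_def)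
  then show ?thesis using \<sigma> R(2) by blast
qed

section \<open>Galois orbits as fibres of the minimal polynomial\<close>

lemma galois_group_ev:
  assumes "\<sigma> \<in> carrier galois_group"
  shows "to_ac.ev f (\<sigma> x) = \<sigma> (to_ac.ev f x)"
proof -
  have \<sigma>: "\<sigma> (a + b) = \<sigma> a + \<sigma> b" "\<sigma> (a * b) = \<sigma> a * \<sigma> b" "\<sigma> (to_ac c) = to_ac c" for a b c
    using assms by (auto simp: galois_group_def ring_iso_def ring_hom_def ring_of_type_algebra_def)
  show ?thesis
    by (induction f) (use \<sigma>(3)[of 0] in \<open>simp_all add: \<sigma>\<close>)
qed

text \<open>An automorphism over K preserves the vanishing of polynomials with coefficients in K.
  Conversely, with equal minimal polynomials the assignment of f(y) to f(x) is a partial embedding,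
  which extends to an automorphism.\<close>

lemma galois_conjugate_iff:
  "(\<exists>\<sigma>\<in>carrier galois_group. \<sigma> x = y) \<longleftrightarrow> min_poly_over x = min_poly_over y"
proof
  assume "\<exists>\<sigma>\<in>carrier galois_group. \<sigma> x = y"
  then obtain \<sigma> where \<sigma>: "\<sigma> \<in> carrier galois_group" "\<sigma> x = y" by blast
  have "inj \<sigma>" using \<sigma>(1) by (auto simp: galois_group_def ring_iso_def ring_of_type_algebra_def bij_def)
  moreover have "\<sigma> 0 = 0" using galois_group_ev[OF \<sigma>(1), of 0] by simp
  ultimately have "\<sigma> a = 0 \<longleftrightarrow> a = 0" for a by (metis injD)
  then show "min_poly_over x = min_poly_over y"
    by (intro min_poly_over_eqI) (simp add: galois_group_ev[OF \<sigma>(1)] flip: \<sigma>(2))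
next
  assume eq: "min_poly_over x = min_poly_over y"
  define R0 where "R0 = {(to_ac.ev f x, to_ac.ev f y) |f. True}"
  have "partial_embedding R0"
    unfolding partial_embedding_def
  proof (intro conjI allI impI)
    fix c
    have "(to_ac.ev [:c:] x, to_ac.ev [:c:] y) \<in> R0" unfolding R0_def by blast
    then show "(to_ac c, to_ac c) \<in> R0" by simp
  next
    fix a b a' b' assume "(a, b) \<in> R0" "(a', b') \<in> R0"
    then obtain f g where [simp]: "a = to_ac.ev f x" "b = to_ac.ev f y" "a' = to_ac.ev g x" "b' = to_ac.ev g y"
      unfolding R0_def by blast
    have "(to_ac.ev (f + g) x, to_ac.ev (f + g) y) \<in> R0" "(to_ac.ev (f * g) x, to_ac.ev (f * g) y) \<in> R0"
      unfolding R0_def by blast+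
    then show "(a + a', b + b') \<in> R0" "(a * a', b * b') \<in> R0" by simp_all
  next
    fix z assume "(0, z) \<in> R0"
    then obtain f where "to_ac.ev f x = 0" "z = to_ac.ev f y" unfolding R0_def by auto
    then show "z = 0" by (simp add: eq flip: min_poly_over_dvd_iff)
  qed
  then obtain \<sigma> where "\<sigma> \<in> carrier galois_group" "\<forall>(a, b)\<in>R0. \<sigma> a = b"
    using partial_embedding_extends_to_automorphism by blast
  moreover have "(x, y) \<in> R0"
  proof -
    have "(to_ac.ev [:0, 1:] x, to_ac.ev [:0, 1:] y) \<in> R0" unfolding R0_def by blast
    then show ?thesis by simp
  qed
  ultimately show "\<exists>\<sigma>\<in>carrier galois_group. \<sigma> x = y" by fast
qed

text \<open>Consequently \<open>orbit_poly\<close> is well defined on orbits and takes different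
  values on different orbits.\<close>

lemma galois_orbit: "orbit galois_group (\<lambda>\<sigma>. \<sigma>) x = {y. min_poly_over y = min_poly_over x}"
  unfolding orbit_def using galois_conjugate_iff[of x] by (auto, metis+)

lemma orbit_poly_galois_orbit: "orbit_poly {y. min_poly_over y = min_poly_over x} = min_poly_over x"
  unfolding orbit_poly_def by (rule the_equality) auto

lemma eigenvalue_orbits_eq:
  "eigenvalue_orbits S = (\<lambda>x. {y. min_poly_over y = min_poly_over x}) ` eigenvalues S"
  unfolding eigenvalue_orbits_def orbits_def galois_orbit by blast

lemma inj_on_orbit_poly: "inj_on orbit_poly (eigenvalue_orbits S)"
  unfolding eigenvalue_orbits_eq by (rule inj_onI) (auto simp: orbit_poly_galois_orbit)

subsection \<open>Fourier analysis of Cayley graphs\<close>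

lemma matrix_smult_nth [simp]: "matrix_smult c A $ i $ j = c * A $ i $ j"
  by (simp add: matrix_smult_def map_matrix_def)

lemma matrix_mult_nth: "(A ** B) $ i $ j = (\<Sum>k\<in>UNIV. A $ i $ k * B $ k $ j)"
  by (simp add: matrix_matrix_mult_def)

lemma matrix_mult_smult_right: "A ** matrix_smult c B = matrix_smult c (A ** B)"
  by (simp add: vec_eq_iff matrix_mult_nth sum_distrib_left mult.left_commute)

lemma matrix_mult_smult_left: "matrix_smult c A ** B = matrix_smult c (A ** B)"
  by (simp add: vec_eq_iff matrix_mult_nth sum_distrib_left mult.assoc)

lemma matrix_smult_add_left: "matrix_smult (c + d) A = matrix_smult c A + matrix_smult d A"
  by (simp add: vec_eq_iff distrib_right)

lemma matrix_smult_smult: "matrix_smult c (matrix_smult d A) = matrix_smult (c * d) A"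
  by (simp add: vec_eq_iff mult.assoc)

lemma matrix_smult_0 [simp]: "matrix_smult 0 A = 0"
  by (simp add: vec_eq_iff)

lemma matrix_smult_1 [simp]: "matrix_smult 1 A = A"
  by (simp add: vec_eq_iff)

lemma matrix_smult_sum: "matrix_smult c (\<Sum>i\<in>I. f i) = (\<Sum>i\<in>I. matrix_smult c (f i))"
  by (simp add: vec_eq_iff sum_component sum_distrib_left)

lemma matrix_mult_sum_right: "A ** (\<Sum>i\<in>I. f i) = (\<Sum>i\<in>I. A ** f i)"
  by (induction I rule: infinite_finite_induct) (simp_all add: matrix_add_ldistrib)

lemma matrix_mult_add_left: "(A + B) ** C = A ** C + B ** C"
  by (simp add: vec_eq_iff matrix_mult_nth distrib_right sum.distrib)

lemma poly_matrix_eq_sum: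
  assumes "Polynomial.degree f \<le> n"
  shows "poly_matrix f A = (\<Sum>i\<le>n. matrix_smult (Polynomial.coeff f i) (matrix_pow A i))"
  unfolding poly_matrix_def using assms
  by (intro sum.mono_neutral_left) (auto simp: coeff_eq_0)

lemma poly_matrix_0 [simp]: "poly_matrix 0 A = 0"
  by (simp add: poly_matrix_def)

lemma poly_matrix_add: "poly_matrix (f + g) A = poly_matrix f A + poly_matrix g A"
proof -
  define n where "n = max (Polynomial.degree f) (Polynomial.degree g)"
  have "Polynomial.degree (f + g) \<le> n" "Polynomial.degree f \<le> n" "Polynomial.degree g \<le> n"
    by (auto simp: n_def degree_add_le_max)
  then show ?thesis
    by (simp add: poly_matrix_eq_sum[of _ n] matrix_smult_add_left sum.distrib)
qed

lemma poly_matrix_smult: "poly_matrix (Polynomial.smult c f) A = matrix_smult c (poly_matrix f A)"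
  using degree_smult_le[of c f]
  by (simp add: poly_matrix_eq_sum[of _ "Polynomial.degree f"] matrix_smult_sum matrix_smult_smult)

text \<open>Horner's rule, the basis of the inductions over polynomials below.\<close>

lemma poly_matrix_pCons:
  "poly_matrix (pCons c f) A = matrix_smult c (mat 1) + A ** poly_matrix f A"
proof -
  have "poly_matrix (pCons c f) A =
      (\<Sum>i\<le>Suc (Polynomial.degree f). matrix_smult (Polynomial.coeff (pCons c f) i) (matrix_pow A i))"
    by (rule poly_matrix_eq_sum) (rule degree_pCons_le)
  also have "\<dots> = matrix_smult c (mat 1) + A ** poly_matrix f A"
    by (subst sum.atMost_Suc_shift)
      (simp add: poly_matrix_def matrix_mult_sum_right matrix_mult_smult_right)
  finally show ?thesis .
qed

lemma poly_matrix_1 [simp]: "poly_matrix 1 A = mat 1"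
  by (simp add: one_pCons poly_matrix_pCons)

lemma poly_matrix_mult: "poly_matrix (f * g) A = poly_matrix f A ** poly_matrix g A"
proof (induction f)
  case (pCons c f)
  then show ?case
    by (simp add: poly_matrix_add poly_matrix_smult poly_matrix_pCons matrix_mult_add_left
        matrix_mult_smult_left matrix_mul_assoc)
qed simp

lemma poly_matrix_diff: "poly_matrix (f - g) A = poly_matrix f A - poly_matrix g A"
  using poly_matrix_add[of "f - g" g A] by simp

lemma matrix_min_poly_eqI:
  assumes "Polynomial.lead_coeff p = 1" "\<And>f. poly_matrix f A = 0 \<longleftrightarrow> p dvd f"
  shows "matrix_min_poly A = p"
  unfolding matrix_min_poly_def
proof (rule the_equality)
  show "Polynomial.lead_coeff p = 1 \<and> poly_matrix p A = 0 \<and> (\<forall>q. poly_matrix q A = 0 \<longrightarrow> p dvd q)"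
    using assms by simp
  fix q assume "Polynomial.lead_coeff q = 1 \<and> poly_matrix q A = 0 \<and> (\<forall>f. poly_matrix f A = 0 \<longrightarrow> q dvd f)"
  then show "q = p" using assms by (intro monic_dvd_antisym) simp_all
qed

lemma matrix_generated_algebra_presentation:
  fixes A :: "('k::field, 'g::finite) sq_matrix"
  assumes "\<And>f. poly_matrix f A = 0 \<longleftrightarrow> p dvd f"
  shows "poly_algebra_presentation (\<lambda>f. poly_matrix f A) p (matrix_generated_algebra A)"
  by unfold_locales
    (simp_all add: matrix_generated_algebra_def poly_matrix_add poly_matrix_mult poly_matrix_smult
      assms[symmetric] poly_matrix_diff)

text \<open>Characters with values in an arbitrary field, so that complex characters and those with
  values in the algebraic closure of K are treated alike.\<close>

definition group_characters :: "('g::ab_group_add \<Rightarrow> 'l::field) set" where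
  "group_characters = {\<psi>. (\<forall>g. \<psi> g \<noteq> 0) \<and> (\<forall>g h. \<psi> (g + h) = \<psi> g * \<psi> h)}"

lemma group_character_0: "\<psi> \<in> group_characters \<Longrightarrow> \<psi> 0 = 1"
proof -
  assume \<psi>: "\<psi> \<in> group_characters"
  then have "\<psi> (0 + 0) = \<psi> 0 * \<psi> 0" unfolding group_characters_def by blast
  with \<psi> show ?thesis by (simp add: group_characters_def)
qed

lemma sum_translate:
  fixes f :: "'g::{finite,ab_group_add} \<Rightarrow> 'a::comm_monoid_add"
  shows "(\<Sum>x\<in>UNIV. f (x + t)) = (\<Sum>x\<in>UNIV. f x)"
  by (rule sum.reindex_bij_witness[of _ "\<lambda>x. x - t" "\<lambda>x. x + t"]) simp_all

lemma prod_translate: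
  fixes f :: "'g::{finite,ab_group_add} \<Rightarrow> 'a::comm_monoid_mult"
  shows "(\<Prod>x\<in>UNIV. f (x + t)) = (\<Prod>x\<in>UNIV. f x)"
  by (rule prod.reindex_bij_witness[of _ "\<lambda>x. x - t" "\<lambda>x. x + t"]) simp_all

text \<open>Translating by \<open>g\<close> permutes the group, so it preserves the product of all
  values of the character while multiplying it by the power in question; the product is nonzero and
  cancels.\<close>

lemma group_character_power_card:
  fixes \<psi> :: "'g::{finite,ab_group_add} \<Rightarrow> 'l::field"
  assumes "\<psi> \<in> group_characters"
  shows "\<psi> g ^ CARD('g) = 1"
proof -
  have "(\<Prod>x\<in>UNIV. \<psi> x) = (\<Prod>x\<in>UNIV. \<psi> (x + g))" by (rule prod_translate[symmetric])
  also have "\<dots> = (\<Prod>x\<in>UNIV. \<psi> x) * \<psi> g ^ CARD('g)"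
    using assms by (simp add: group_characters_def prod.distrib)
  finally show ?thesis using assms by (simp add: group_characters_def)
qed

text \<open>All values are among the finitely many roots of \<open>x ^ CARD('g) - 1\<close>.\<close>

lemma finite_group_characters: "finite (group_characters :: ('g::{finite,ab_group_add} \<Rightarrow> 'l::field) set)"
proof (rule finite_subset)
  let ?Z = "{z :: 'l. poly (Polynomial.monom 1 CARD('g) - 1) z = 0}"
  have "Polynomial.coeff (Polynomial.monom 1 CARD('g) - 1 :: 'l poly) CARD('g) \<noteq> 0"
    by (simp add: coeff_1)
  then have "Polynomial.monom 1 CARD('g) - 1 \<noteq> (0 :: 'l poly)" by (metis coeff_0)
  then have "finite ?Z" by (rule poly_roots_finite)
  then show "finite (PiE (UNIV :: 'g set) (\<lambda>_. ?Z))" by (intro finite_PiE) auto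
  show "group_characters \<subseteq> PiE (UNIV :: 'g set) (\<lambda>_. ?Z)"
    using group_character_power_card by (fastforce simp: poly_monom)
qed

section \<open>Common eigenvectors of translations are characters\<close>

lemma matrix_vector_scale: "A *v (c *s v) = c *s (A *v (v :: 'a::comm_ring_1 ^ 'n::finite))"
  by (simp add: vec_eq_iff matrix_vector_mult_def sum_distrib_left mult.left_commute)

lemma matrix_smult_vector: "matrix_smult c A *v v = c *s (A *v v)"
  by (simp add: vec_eq_iff matrix_vector_mult_def sum_distrib_left mult.assoc)

lemma poly_matrix_pCons_vector:
  "poly_matrix (pCons c f) A *v v = c *s v + A *v (poly_matrix f A *v v)"
  by (simp add: poly_matrix_pCons matrix_vector_mult_add_rdistrib matrix_smult_vector matrix_vector_mul_assoc)

text \<open>Let \<open>q\<close> have least degree among the nonzero polynomials with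
  \<open>q(A) v = 0\<close>. Splitting off a root \<open>c\<close> gives
  \<open>q = (x - c) * r\<close>, and \<open>r(A) v\<close> is nonzero by minimality.\<close>

lemma eigenvector_exists:
  fixes A :: "('l::alg_closed_field, 'g::finite) sq_matrix"
  assumes "v \<noteq> 0" "q0 \<noteq> 0" "poly_matrix q0 A *v v = 0"
  obtains r c where "poly_matrix r A *v v \<noteq> 0" "A *v (poly_matrix r A *v v) = c *s (poly_matrix r A *v v)"
proof -
  define P where "P q \<longleftrightarrow> q \<noteq> 0 \<and> poly_matrix q A *v v = 0" for q
  have "P q0" using assms by (simp add: P_def)
  then obtain q where q: "P q" and least: "\<And>f. P f \<Longrightarrow> Polynomial.degree q \<le> Polynomial.degree f"
    using ex_has_least_nat[of P q0 Polynomial.degree] by blast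
  have "Polynomial.degree q > 0"
  proof (rule ccontr)
    assume "\<not> Polynomial.degree q > 0"
    then obtain c where c: "q = [:c:]" using degree_eq_zeroE by blast
    have "c \<noteq> 0" using q by (simp add: P_def c)
    moreover have "poly_matrix q A *v v = c *s v" by (simp add: c poly_matrix_pCons_vector)
    ultimately show False using assms(1) q by (simp add: P_def)
  qed
  then obtain c where "poly q c = 0" using alg_closed_imp_poly_has_root by blast
  then obtain r where r: "q = [:- c, 1:] * r" by (auto simp: poly_eq_0_iff_dvd elim: dvdE)
  have "r \<noteq> 0" using q r by (auto simp: P_def)
  then have "Polynomial.degree r < Polynomial.degree q" unfolding r by (subst degree_mult_eq) auto
  then have "\<not> P r" using least by fastforce
  then have "poly_matrix r A *v v \<noteq> 0" using \<open>r \<noteq> 0\<close> by (simp add: P_def)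
  moreover have "A *v (poly_matrix r A *v v) = c *s (poly_matrix r A *v v)"
  proof -
    have "poly_matrix q A *v v = (- c) *s (poly_matrix r A *v v) + A *v (poly_matrix r A *v v)"
      unfolding r poly_matrix_mult
      by (simp only: matrix_vector_mul_assoc[symmetric] poly_matrix_pCons_vector) simp
    then show ?thesis using q by (simp add: P_def vec_eq_iff)
  qed
  ultimately show ?thesis by (rule that)
qed

definition translation :: "'g::{finite,ab_group_add} \<Rightarrow> ('l::comm_ring_1, 'g) sq_matrix" where
  "translation h = (\<chi> x y. if y = x + h then 1 else 0)"

lemma translation_vector: "(translation h *v v) $ x = v $ (x + h)"
  by (simp add: translation_def matrix_vector_mult_def if_distrib[of "\<lambda>z. z * _"] cong: if_cong)

lemma translation_mult: "translation g ** translation h = translation (g + h)"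
proof -
  have "(translation g ** translation h) $ x $ y = (translation (g + h) :: ('a, 'b) sq_matrix) $ x $ y" for x y
    by (simp add: translation_def matrix_mult_nth if_distrib[of "\<lambda>z. z * _"] add.assoc cong: if_cong)
  then show ?thesis by (simp add: vec_eq_iff)
qed

lemma matrix_pow_translation: "\<exists>g. matrix_pow (translation h) n = translation g"
proof (induction n)
  case 0
  have "mat 1 = translation 0" by (simp add: vec_eq_iff translation_def mat_def eq_commute)
  then show ?case by (metis matrix_pow.simps(1))
qed (auto simp: translation_mult)

text \<open>Two powers of a translation coincide by the pigeonhole principle.\<close>

lemma translation_annihilated:
  fixes h :: "'g::{finite,ab_group_add}"
  obtains q where "q \<noteq> 0" "poly_matrix q (translation h :: ('l::field, 'g) sq_matrix) = 0"
proof -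
  let ?T = "translation h :: ('l, 'g) sq_matrix"
  have "range (matrix_pow ?T) \<subseteq> range translation"
    using matrix_pow_translation by fast
  then have "finite (range (matrix_pow ?T))" by (rule finite_subset) simp
  then have "\<not> inj (matrix_pow ?T)" using finite_imageD infinite_UNIV_nat by blast
  then obtain i j where ij: "i \<noteq> j" "matrix_pow ?T i = matrix_pow ?T j" by (auto simp: inj_def)
  have monom: "poly_matrix (Polynomial.monom 1 n) ?T = matrix_pow ?T n" for n
    by (induction n) (simp_all add: monom_0 monom_Suc poly_matrix_pCons)
  have "Polynomial.monom 1 i - Polynomial.monom 1 j \<noteq> (0 :: 'l poly)"
    using ij(1) by (simp add: monom_eq_iff')
  moreover have "poly_matrix (Polynomial.monom 1 i - Polynomial.monom 1 j) ?T = 0"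
    using ij(2) by (simp add: poly_matrix_diff monom)
  ultimately show ?thesis by (rule that)
qed

context
  fixes W :: "('l::alg_closed_field, 'g::{finite,ab_group_add}) vec set"
  assumes W_add: "\<And>u v. u \<in> W \<Longrightarrow> v \<in> W \<Longrightarrow> u + v \<in> W"
    and W_scale: "\<And>c v. v \<in> W \<Longrightarrow> c *s v \<in> W"
    and W_translation: "\<And>h v. v \<in> W \<Longrightarrow> translation h *v v \<in> W"
begin

lemma invariant_subspace_poly:
  assumes "v \<in> W"
  shows "poly_matrix q (translation h) *v v \<in> W"
proof (induction q)
  case 0
  show ?case using W_scale[OF assms, of 0] by simp
next
  case (pCons c q)
  then show ?case
    unfolding poly_matrix_pCons_vector by (intro W_add W_scale W_translation assms)
qed

text \<open>Translations commute because the group is abelian.\<close>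

lemma translation_poly_commute:
  "translation g *v (poly_matrix q (translation h) *v v) = poly_matrix q (translation h) *v (translation g *v v)"
proof (induction q)
  case 0
  then show ?case by simp
next
  case (pCons c q)
  have comm: "translation g *v (translation h *v u) = translation h *v (translation g *v u)" for u
    by (simp add: matrix_vector_mul_assoc translation_mult add.commute)
  then show ?case
    by (simp add: poly_matrix_pCons_vector matrix_vector_right_distrib matrix_vector_scale pCons.IH
        comm[of "poly_matrix q (translation h) *v v"])
qed

text \<open>The translations are added one at a time. The new eigenvector is the old one with a
  polynomial in the new translation applied, so by commutation it stays an eigenvector of the
  earlier translations, and by invariance it stays in \<open>W\<close>.\<close>

lemma common_eigenvector:
  assumes "v \<in> W" "v \<noteq> 0" "finite F"
  shows "\<exists>u\<in>W. u \<noteq> 0 \<and> (\<forall>h\<in>F. \<exists>c. translation h *v u = c *s u)"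
  using assms(3)
proof induction
  case empty
  show ?case using assms by auto
next
  case (insert h F)
  then obtain u where u: "u \<in> W" "u \<noteq> 0" "\<forall>g\<in>F. \<exists>c. translation g *v u = c *s u" by blast
  let ?T = "translation h :: ('l, 'g) sq_matrix"
  obtain q where "q \<noteq> 0" "poly_matrix q ?T = 0" using translation_annihilated by blast
  then obtain r c where r: "poly_matrix r ?T *v u \<noteq> 0"
    "?T *v (poly_matrix r ?T *v u) = c *s (poly_matrix r ?T *v u)"
    using eigenvector_exists[OF u(2), of q ?T] by auto
  have "\<exists>c. translation g *v (poly_matrix r ?T *v u) = c *s (poly_matrix r ?T *v u)" if "g \<in> F" for g
    using u(3) that by (auto simp: translation_poly_commute matrix_vector_scale)
  then show ?case
    using r invariant_subspace_poly[OF u(1)] by (intro bexI[of _ "poly_matrix r ?T *v u"]) auto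
qed

text \<open>For a common eigenvector \<open>u\<close>, the eigenvalue \<open>c h\<close> satisfies
  \<open>u(x + h) = c h * u(x)\<close>. Hence \<open>u\<close> is \<open>u(0)\<close> times
  \<open>c\<close>, and \<open>c\<close> is multiplicative.\<close>

lemma invariant_subspace_contains_character:
  assumes "v \<in> W" "v \<noteq> 0"
  shows "\<exists>\<psi>\<in>group_characters. (\<chi> x. \<psi> x) \<in> W"
proof -
  obtain u where u: "u \<in> W" "u \<noteq> 0" "\<forall>h. \<exists>c. translation h *v u = c *s u"
    using common_eigenvector[OF assms, of UNIV] by auto
  then obtain c where "\<And>h. translation h *v u = c h *s u" by metis
  then have c: "u $ (x + h) = c h * u $ x" for x h
    by (metis translation_vector vector_smult_component)
  have u0: "u $ x = c x * u $ 0" for x using c[of 0 x] by simp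
  have nz: "u $ 0 \<noteq> 0"
  proof
    assume "u $ 0 = 0"
    then have "u $ x = 0" for x by (subst u0) simp
    then have "u = 0" by (simp add: vec_eq_iff)
    with u(2) show False ..
  qed
  have mult: "c (g + h) = c g * c h" for g h
    using c[of g h] u0[of "g + h"] u0[of g] nz by simp
  have "c 0 = 1" using u0[of 0] nz by simp
  then have "c g \<noteq> 0" for g using mult[of g "- g"] by auto
  with mult have "c \<in> group_characters" by (simp add: group_characters_def)
  moreover have "(\<chi> x. c x) = inverse (u $ 0) *s u"
  proof -
    have "c x = inverse (u $ 0) * u $ x" for x using nz by (simp add: u0[of x])
    then show ?thesis by (simp add: vec_eq_iff)
  qed
  ultimately show ?thesis using W_scale[OF u(1)] by metis
qed

end

text \<open>The vectors with vanishing Fourier transform form a translation invariant space. A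
  character \<open>\<psi>\<close> in it would have transform \<open>CARD('g) \<noteq> 0\<close> at \<open>1/\<psi>\<close>.\<close>

lemma fourier_transform_injective:
  fixes v :: "('l::alg_closed_field, 'g::{finite,ab_group_add}) vec"
  assumes char: "\<not> CHAR('l) dvd CARD('g)"
    and v: "\<And>\<psi>. \<psi> \<in> group_characters \<Longrightarrow> (\<Sum>x\<in>UNIV. v $ x * \<psi> x) = 0"
  shows "v = 0"
proof (rule ccontr)
  assume nz: "v \<noteq> 0"
  define W where "W = {v :: ('l, 'g) vec. \<forall>\<psi>\<in>group_characters. (\<Sum>x\<in>UNIV. v $ x * \<psi> x) = 0}"
  have "\<exists>\<psi>\<in>group_characters. (\<chi> x. \<psi> x) \<in> W"
  proof (rule invariant_subspace_contains_character)
    show "v \<in> W" using v by (simp add: W_def)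
    show "u + w \<in> W" if "u \<in> W" "w \<in> W" for u w
      using that by (simp add: W_def distrib_right sum.distrib)
    show "c *s w \<in> W" if "w \<in> W" for c w
      using that by (simp add: W_def mult.assoc flip: sum_distrib_left)
    show "translation h *v w \<in> W" if w: "w \<in> W" for h w
      unfolding W_def mem_Collect_eq
    proof
      fix \<psi> :: "'g \<Rightarrow> 'l" assume \<psi>: "\<psi> \<in> group_characters"
      \<comment> \<open>Translation changes the Fourier transform at \<open>\<psi>\<close> only by a
        nonzero factor, as the substitution of \<open>x + h\<close> for \<open>x\<close>
        shows.\<close>
      have "(\<Sum>x\<in>UNIV. (translation h *v w) $ x * \<psi> x) * \<psi> h = (\<Sum>x\<in>UNIV. w $ (x + h) * \<psi> (x + h))"
        using \<psi> by (simp add: translation_vector sum_distrib_right group_characters_def mult.assoc)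
      also have "\<dots> = (\<Sum>x\<in>UNIV. w $ x * \<psi> x)" by (rule sum_translate)
      also have "\<dots> = 0" using w \<psi> by (simp add: W_def)
      finally show "(\<Sum>x\<in>UNIV. (translation h *v w) $ x * \<psi> x) = 0"
        using \<psi> by (simp add: group_characters_def)
    qed
  qed fact
  then obtain \<psi> :: "'g \<Rightarrow> 'l" where \<psi>: "\<psi> \<in> group_characters" "(\<chi> x. \<psi> x) \<in> W" by blast
  have "(\<lambda>x. inverse (\<psi> x)) \<in> group_characters" using \<psi>(1) by (simp add: group_characters_def)
  then have "(\<Sum>x\<in>UNIV. \<psi> x * inverse (\<psi> x)) = 0" using \<psi>(2) by (simp add: W_def)
  moreover have "\<psi> x * inverse (\<psi> x) = 1" for x using \<psi>(1) by (simp add: group_characters_def)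
  ultimately have "of_nat CARD('g) = (0 :: 'l)" by simp
  with char show False by (simp add: of_nat_eq_0_iff_char_dvd)
qed

section \<open>Fourier transform of polynomials in the adjacency matrix\<close>

lemma poly_matrix_cayley_translate:
  fixes S :: "'g::{finite,ab_group_add} set"
  shows "poly_matrix f (cayley_matrix S) $ (g + t) $ (h + t) = poly_matrix f (cayley_matrix S) $ g $ h"
proof (induction f arbitrary: g h)
  case (pCons c f)
  \<comment> \<open>Shifting the summation index by \<open>t\<close> suffices, since the entries of
    the adjacency matrix depend only on differences.\<close>
  have "(cayley_matrix S ** poly_matrix f (cayley_matrix S)) $ (g + t) $ (h + t) =
      (\<Sum>k\<in>UNIV. cayley_matrix S $ (g + t) $ (k + t) * poly_matrix f (cayley_matrix S) $ (k + t) $ (h + t))"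
    unfolding matrix_mult_nth by (rule sum_translate[symmetric])
  also have "\<dots> = (cayley_matrix S ** poly_matrix f (cayley_matrix S)) $ g $ h"
    unfolding matrix_mult_nth by (simp add: pCons.IH) (simp add: cayley_matrix_def)
  finally show ?case by (simp add: poly_matrix_pCons mat_def)
qed simp

lemma sum_cayley_character:
  fixes S :: "'g::{finite,ab_group_add} set"
  assumes "\<psi> \<in> group_characters"
  shows "(\<Sum>k\<in>UNIV. cayley_matrix S $ g $ k * \<psi> k) = (\<Sum>s\<in>S. \<psi> s) * \<psi> g"
proof -
  have "(\<Sum>k\<in>UNIV. cayley_matrix S $ g $ k * \<psi> k) = (\<Sum>k\<in>{k. k - g \<in> S}. \<psi> k)"
    by (rule sum.mono_neutral_cong_right) (auto simp: cayley_matrix_def)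
  also have "\<dots> = (\<Sum>s\<in>S. \<psi> (s + g))"
    by (rule sum.reindex_bij_witness[of _ "\<lambda>s. s + g" "\<lambda>k. k - g"]) auto
  also have "\<dots> = (\<Sum>s\<in>S. \<psi> s) * \<psi> g"
    using assms by (simp add: group_characters_def sum_distrib_right)
  finally show ?thesis .
qed

context field_embedding
begin

text \<open>A character is an eigenvector of A, hence of f(A) with eigenvalue f of the character
  sum; \<open>e\<close> carries the entries over K into the field where the character takes its
  values.\<close>

lemma poly_matrix_cayley_character:
  fixes S :: "'g::{finite,ab_group_add} set"
  assumes \<psi>: "\<psi> \<in> group_characters"
  shows "(\<Sum>h\<in>UNIV. e (poly_matrix f (cayley_matrix S) $ g $ h) * \<psi> h) = ev f (\<Sum>s\<in>S. \<psi> s) * \<psi> g"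
proof (induction f arbitrary: g)
  case (pCons c f)
  let ?A = "cayley_matrix S" and ?l = "\<Sum>s\<in>S. \<psi> s"
  have "(\<Sum>h\<in>UNIV. e ((?A ** poly_matrix f ?A) $ g $ h) * \<psi> h) =
      (\<Sum>h\<in>UNIV. \<Sum>k\<in>UNIV. e (?A $ g $ k) * (e (poly_matrix f ?A $ k $ h) * \<psi> h))"
    by (simp add: matrix_mult_nth hom_sum sum_distrib_right mult.assoc)
  also have "\<dots> = (\<Sum>k\<in>UNIV. e (?A $ g $ k) * (ev f ?l * \<psi> k))"
    by (subst sum.swap) (simp add: pCons.IH flip: sum_distrib_left)
  also have "\<dots> = ev f ?l * (\<Sum>k\<in>UNIV. cayley_matrix S $ g $ k * \<psi> k)"
    unfolding sum_distrib_left
    by (rule sum.cong) (auto simp: cayley_matrix_def)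
  also have "\<dots> = ?l * ev f ?l * \<psi> g"
    by (simp add: sum_cayley_character[OF \<psi>])
  finally have 1: "(\<Sum>h\<in>UNIV. e ((?A ** poly_matrix f ?A) $ g $ h) * \<psi> h) = ?l * ev f ?l * \<psi> g" .
  have "(\<Sum>h\<in>UNIV. e (c * mat 1 $ g $ h) * \<psi> h) = (\<Sum>h\<in>UNIV. if h = g then e c * \<psi> h else 0)"
    by (rule sum.cong) (auto simp: mat_def)
  then have 2: "(\<Sum>h\<in>UNIV. e (c * mat 1 $ g $ h) * \<psi> h) = e c * \<psi> g" by simp
  show ?case
    using 1 2 by (simp add: poly_matrix_pCons distrib_right sum.distrib)
qed simp

end

text \<open>If f vanishes at all character sums, row 0 of f(A) has zero Fourier transform and so is
  zero; translation invariance then kills the other rows. Leaving the target field free allows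
  comparing the algebraic closure of the rationals with the complex numbers.\<close>

lemma poly_matrix_cayley_eq_0_iff:
  fixes S :: "'g::{finite,ab_group_add} set" and e :: "'k::field \<Rightarrow> 'l::alg_closed_field"
  assumes "field_embedding e" "\<not> CHAR('l) dvd CARD('g)"
  shows "poly_matrix f (cayley_matrix S) = 0 \<longleftrightarrow>
    (\<forall>\<psi>\<in>group_characters. poly (map_poly e f) (\<Sum>s\<in>S. \<psi> s) = 0)"
proof
  interpret field_embedding e by fact
  let ?B = "poly_matrix f (cayley_matrix S)"
  {
    assume B: "?B = 0"
    show "\<forall>\<psi>\<in>group_characters. ev f (\<Sum>s\<in>S. \<psi> s) = 0"
    proof
      fix \<psi> :: "'g \<Rightarrow> 'l" assume \<psi>: "\<psi> \<in> group_characters"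
      show "ev f (\<Sum>s\<in>S. \<psi> s) = 0"
        using poly_matrix_cayley_character[OF \<psi>, of f S 0] by (simp add: B group_character_0[OF \<psi>])
    qed
  next
    assume roots: "\<forall>\<psi>\<in>group_characters. ev f (\<Sum>s\<in>S. \<psi> s) = 0"
    have "(\<chi> h. e (?B $ 0 $ h)) = 0"
      using assms(2) by (rule fourier_transform_injective) (simp add: poly_matrix_cayley_character roots)
    then have "?B $ 0 $ h = 0" for h by (simp add: vec_eq_iff)
    then have "?B $ g $ h = 0" for g h
      using poly_matrix_cayley_translate[of f S 0 g "h - g"] by simp
    then show "?B = 0" by (simp add: vec_eq_iff)
  }
qed

subsection \<open>The spectral algebra\<close>

lemma eigenvalues_eq: "eigenvalues S = (\<lambda>\<psi>. \<Sum>s\<in>S. \<psi> s) ` group_characters"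
  by (simp add: eigenvalues_def characters_def group_characters_def)

context
  fixes S :: "'g::{finite,ab_group_add} set"
  assumes char_K: "\<not> CHAR('k::field) dvd CARD('g)"
begin

abbreviation (input) "Orbs \<equiv> eigenvalue_orbits S :: 'k alg_closure set set"

lemma finite_eigenvalue_orbits: "finite Orbs"
  unfolding eigenvalue_orbits_eq eigenvalues_eq by (intro finite_imageI finite_group_characters)

lemma orbit_poly_monic_irreducible:
  assumes "\<O> \<in> Orbs"
  shows "Polynomial.lead_coeff (orbit_poly \<O>) = 1" "Factorial_Ring.irreducible (orbit_poly \<O>)"
  using assms lead_coeff_min_poly_over irreducible_min_poly_over
  by (auto simp: eigenvalue_orbits_eq orbit_poly_galois_orbit)

lemma orbit_poly_comaximal:
  assumes "\<O> \<in> Orbs" "\<O>' \<in> Orbs" "\<O> \<noteq> \<O>'"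
  shows "comaximal (orbit_poly \<O>) (orbit_poly \<O>')"
  using assms inj_on_orbit_poly[of S]
  by (intro irreducible_monic_comaximal orbit_poly_monic_irreducible) (auto dest: inj_onD)

lemma poly_matrix_cayley_eq_0_iff_prod_dvd:
  "poly_matrix f (cayley_matrix S) = 0 \<longleftrightarrow> (\<Prod>\<O>\<in>Orbs. orbit_poly \<O>) dvd f"
proof -
  have "poly_matrix f (cayley_matrix S) = 0 \<longleftrightarrow>
      (\<forall>x\<in>eigenvalues S :: 'k alg_closure set. to_ac.ev f x = 0)"
    unfolding eigenvalues_eq using char_K
    by (subst poly_matrix_cayley_eq_0_iff[OF to_ac.field_embedding_axioms]) auto
  also have "\<dots> \<longleftrightarrow> (\<forall>\<O>\<in>Orbs. orbit_poly \<O> dvd f)"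
    by (simp add: eigenvalue_orbits_eq orbit_poly_galois_orbit min_poly_over_dvd_iff)
  also have "\<dots> \<longleftrightarrow> (\<Prod>\<O>\<in>Orbs. orbit_poly \<O>) dvd f"
    by (rule comaximal_prod_dvd_iff[symmetric]) (auto intro: finite_eigenvalue_orbits orbit_poly_comaximal)
  finally show ?thesis .
qed

lemma cayley_min_poly_eq: "cayley_min_poly S = (\<Prod>\<O>\<in>Orbs. orbit_poly \<O>)"
  unfolding cayley_min_poly_def
  by (rule matrix_min_poly_eqI)
    (simp_all add: poly_matrix_cayley_eq_0_iff_prod_dvd orbit_poly_monic_irreducible lead_coeff_prod)

lemma squarefree_prod_orbit_poly: "squarefree (\<Prod>\<O>\<in>Orbs. orbit_poly \<O>)"
  by (intro squarefree_prod_irreducible finite_eigenvalue_orbits orbit_poly_monic_irreducible orbit_poly_comaximal)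

lemma spectral_algebra_presentation:
  "poly_algebra_presentation (\<lambda>f. poly_matrix f (cayley_matrix S)) (\<Prod>\<O>\<in>Orbs. orbit_poly \<O>) (spectral_algebra S)"
  unfolding spectral_algebra_def
  by (rule matrix_generated_algebra_presentation) (rule poly_matrix_cayley_eq_0_iff_prod_dvd)

lemma spectral_algebra_isomorphic:
  "algebra_isomorphic (ring_of_type_algebra :: 'k ring) (spectral_algebra S)
     (product_algebra Orbs (\<lambda>\<O>. poly_quotient (orbit_poly \<O>)))"
  by (rule poly_algebra_presentation_isomorphic[OF spectral_algebra_presentation],
      rule product_algebra_presentation[OF finite_eigenvalue_orbits orbit_poly_comaximal poly_quotient_presentation])

lemma semisimple_spectral_algebra: "semisimple_ring (spectral_algebra S :: ('k, ('k, 'g) sq_matrix) module)"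
  using spectral_algebra_presentation squarefree_prod_orbit_poly
  unfolding poly_algebra_presentation_def by (blast intro: poly_presentation.semisimple_M)

text \<open>Otherwise the product of the other factors would vanish at all eigenvalues in \<open>L\<close> and
  hence annihilate the adjacency matrix, contradicting minimality.\<close>

lemma orbit_poly_has_root_in_extension:
  fixes e :: "'k \<Rightarrow> 'l::alg_closed_field"
  assumes e: "field_embedding e" "\<not> CHAR('l) dvd CARD('g)" and \<O>: "\<O> \<in> Orbs"
  shows "\<exists>\<psi>\<in>group_characters. poly (map_poly e (orbit_poly \<O>)) (\<Sum>s\<in>S. \<psi> s) = 0"
proof (rule ccontr)
  interpret field_embedding e by fact
  assume no_root: "\<not> ?thesis"
  let ?p = "orbit_poly \<O>" and ?q = "\<Prod>\<O>\<in>Orbs - {\<O>}. orbit_poly \<O>"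
  have split: "(\<Prod>\<O>\<in>Orbs. orbit_poly \<O>) = ?p * ?q"
    using \<O> finite_eigenvalue_orbits by (simp add: prod.remove)
  have "poly_matrix (?p * ?q) (cayley_matrix S) = 0"
    unfolding split[symmetric] by (simp only: poly_matrix_cayley_eq_0_iff_prod_dvd dvd_refl)
  then have "\<forall>\<psi>\<in>group_characters. ev (?p * ?q) (\<Sum>s\<in>S. \<psi> s) = 0"
    by (simp only: poly_matrix_cayley_eq_0_iff[OF e])
  then have "\<forall>\<psi>\<in>group_characters. ev ?q (\<Sum>s\<in>S. \<psi> s) = 0"
    using no_root by auto
  then have "poly_matrix ?q (cayley_matrix S) = 0"
    by (simp only: poly_matrix_cayley_eq_0_iff[OF e])
  then have "?p * ?q dvd 1 * ?q"
    by (simp add: poly_matrix_cayley_eq_0_iff_prod_dvd split)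
  moreover have "Polynomial.lead_coeff ?q = 1"
    using orbit_poly_monic_irreducible(1) by (simp add: lead_coeff_prod)
  then have "?q \<noteq> 0" by auto
  ultimately have "?p dvd 1" by (simp only: dvd_mult_cancel_right) simp
  then show False using orbit_poly_monic_irreducible(2)[OF \<O>] by (simp add: Factorial_Ring.irreducible_def)
qed

end

section \<open>Complex roots of unity and the real cyclotomic subfield\<close>

lemma root_of_unity_is_power_of_primitive:
  assumes "primitive_root_of_unity n \<zeta>" "n > 0" "z ^ n = 1"
  shows "\<exists>k. z = \<zeta> ^ k"
proof -
  have \<zeta>: "\<zeta> ^ n = 1" "\<And>k. 0 < k \<Longrightarrow> k < n \<Longrightarrow> \<zeta> ^ k \<noteq> 1"
    using assms(1) by (auto simp: primitive_root_of_unity_def)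
  have nz: "\<zeta> \<noteq> 0" using \<zeta>(1) assms(2) by (auto simp: power_0_left)
  have neq: "\<zeta> ^ i \<noteq> \<zeta> ^ j" if "i < j" "j < n" for i j
  proof
    assume "\<zeta> ^ i = \<zeta> ^ j"
    also have "\<dots> = \<zeta> ^ i * \<zeta> ^ (j - i)" using that by (simp flip: power_add)
    finally have "\<zeta> ^ (j - i) = 1" using nz by simp
    then show False using \<zeta>(2)[of "j - i"] that by simp
  qed
  have "inj_on (\<lambda>k. \<zeta> ^ k) {..<n}"
    by (rule linorder_inj_onI) (use neq in auto)
  \<comment> \<open>The first \<open>n\<close> powers are distinct, so they exhaust the
    \<open>n\<close> complex roots of unity of exponent \<open>n\<close>.\<close>
  then have "card ((\<lambda>k. \<zeta> ^ k) ` {..<n}) = n" by (simp add: card_image)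
  moreover have "(\<lambda>k. \<zeta> ^ k) ` {..<n} \<subseteq> {z. z ^ n = 1}"
    using \<zeta>(1) by (auto simp flip: power_mult) (metis mult.commute power_mult power_one)
  moreover have "finite {z :: complex. z ^ n = 1}" "card {z :: complex. z ^ n = 1} = n"
    using assms(2) card_roots_unity_eq[of n] finite_roots_unity[of n] by auto
  ultimately have "(\<lambda>k. \<zeta> ^ k) ` {..<n} = {z. z ^ n = 1}" by (intro card_subset_eq) auto
  then show ?thesis using assms(3) by blast
qed

lemma
  shows rational_adjoin_self: "z \<in> rational_adjoin z"
    and rational_adjoin_of_rat: "of_rat q \<in> rational_adjoin z"
    and rational_adjoin_add: "a \<in> rational_adjoin z \<Longrightarrow> b \<in> rational_adjoin z \<Longrightarrow> a + b \<in> rational_adjoin z"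
    and rational_adjoin_mult: "a \<in> rational_adjoin z \<Longrightarrow> b \<in> rational_adjoin z \<Longrightarrow> a * b \<in> rational_adjoin z"
  unfolding rational_adjoin_def
  using generate_field.eng_add[of a ring_of_type_algebra "\<rat> \<union> {z}" b]
    generate_field.eng_mult[of a ring_of_type_algebra "\<rat> \<union> {z}" b]
  by (auto intro: generate_field.incl simp: ring_of_type_algebra_def)

lemma rational_adjoin_sum:
  assumes "\<And>i. i \<in> A \<Longrightarrow> f i \<in> rational_adjoin z"
  shows "(\<Sum>i\<in>A. f i) \<in> rational_adjoin z"
  using assms rational_adjoin_of_rat[of 0]
  by (induction A rule: infinite_finite_induct) (auto intro: rational_adjoin_add)

text \<open>The Chebyshev recursion.\<close>

lemma power_plus_inverse_in_rational_adjoin: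
  assumes "\<zeta> \<noteq> 0"
  shows "\<zeta> ^ k + inverse (\<zeta> ^ k) \<in> rational_adjoin (\<zeta> + inverse \<zeta>)"
proof (induction k rule: less_induct)
  case (less k)
  consider "k = 0" | "k = 1" | j where "k = Suc (Suc j)" by (metis One_nat_def not0_implies_Suc)
  then show ?case
  proof cases
    case 1
    then show ?thesis using rational_adjoin_of_rat[of 2] by (simp add: of_rat_numeral_eq)
  next
    case 2
    then show ?thesis using rational_adjoin_self by simp
  next
    case 3
    have "\<zeta> ^ k + inverse (\<zeta> ^ k) =
        (\<zeta> + inverse \<zeta>) * (\<zeta> ^ Suc j + inverse (\<zeta> ^ Suc j)) + of_rat (-1) * (\<zeta> ^ j + inverse (\<zeta> ^ j))"
    proof -
      have cancel: "\<zeta> * (inverse \<zeta> * x) = x" "inverse \<zeta> * (\<zeta> * x) = x" for x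
        using assms by (simp_all flip: mult.assoc)
      show ?thesis
        by (simp add: 3 distrib_left distrib_right mult.assoc cancel flip: power_inverse)
    qed
    also have "\<dots> \<in> rational_adjoin (\<zeta> + inverse \<zeta>)"
      by (intro rational_adjoin_add[OF rational_adjoin_mult rational_adjoin_mult] less.IH
          rational_adjoin_self rational_adjoin_of_rat) (simp_all add: 3)
    finally show ?thesis .
  qed
qed

lemma complex_eigenvalue_in_rational_adjoin:
  fixes S :: "'g::{finite,ab_group_add} set" and \<psi> :: "'g \<Rightarrow> complex"
  assumes S: "S = uminus ` S" and \<zeta>: "primitive_root_of_unity CARD('g) \<zeta>" and \<psi>: "\<psi> \<in> group_characters"
  shows "(\<Sum>s\<in>S. \<psi> s) \<in> rational_adjoin (\<zeta> + inverse \<zeta>)"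
proof -
  have inv: "\<psi> (- s) = inverse (\<psi> s)" for s
  proof -
    have "\<psi> s * \<psi> (- s) = \<psi> (s + - s)" using \<psi> by (simp only: group_characters_def mem_Collect_eq)
    also have "\<dots> = 1" using group_character_0[OF \<psi>] by simp
    finally show ?thesis by (rule inverse_unique[symmetric])
  qed
  have "(\<Sum>s\<in>S. \<psi> s) = (\<Sum>s\<in>uminus ` S. \<psi> s)" by (rule arg_cong[OF S])
  also have "\<dots> = (\<Sum>s\<in>S. inverse (\<psi> s))" by (subst sum.reindex) (auto simp: inv)
  \<comment> \<open>Averaging the sum with its image under negation avoids choosing representatives
    of the pairs and also covers elements with \<open>s = - s\<close>.\<close>
  finally have "(\<Sum>s\<in>S. \<psi> s) = of_rat (1/2) * (\<Sum>s\<in>S. \<psi> s + inverse (\<psi> s))"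
    by (simp add: sum.distrib of_rat_divide)
  also have "\<dots> \<in> rational_adjoin (\<zeta> + inverse \<zeta>)"
  proof (intro rational_adjoin_mult rational_adjoin_of_rat rational_adjoin_sum)
    fix s
    obtain k where "\<psi> s = \<zeta> ^ k"
      using root_of_unity_is_power_of_primitive[OF \<zeta>] group_character_power_card[OF \<psi>] by auto
    moreover have "\<zeta> \<noteq> 0" using \<zeta> by (auto simp: primitive_root_of_unity_def power_0_left)
    ultimately show "\<psi> s + inverse (\<psi> s) \<in> rational_adjoin (\<zeta> + inverse \<zeta>)"
      using power_plus_inverse_in_rational_adjoin by simp
  qed
  finally show ?thesis .
qed

section \<open>Number fields generated by a root\<close>

context field_embedding
begin

text \<open>The values at \<open>x\<close> of polynomials over the base field form a copy of the
  quotient by \<open>p\<close>, so \<open>field_M\<close> makes this range a subfield.\<close>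

lemma ev_presentation:
  assumes "Factorial_Ring.irreducible p" "ev p x = 0"
  shows "poly_presentation (\<lambda>f. ev f x) p (ring_of_type_algebra \<lparr>carrier := range (\<lambda>f. ev f x)\<rparr>)"
proof
  show "ev f x = ev g x \<longleftrightarrow> p dvd f - g" for f g
    using irreducible_root_iff[OF assms, of "f - g"] by simp
qed (simp_all add: ring_of_type_algebra_def)

lemma subfield_range_ev:
  assumes "Factorial_Ring.irreducible p" "ev p x = 0"
  shows "subfield (range (\<lambda>f. ev f x)) ring_of_type_algebra"
proof (rule ring.subfield_iff(1))
  show "ring (ring_of_type_algebra :: 'l ring)" by (rule ring_from_type_algebra)
  show "field (ring_of_type_algebra \<lparr>carrier := range (\<lambda>f. ev f x)\<rparr>)"
    by (rule poly_presentation.field_M[OF ev_presentation]) fact+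
qed (simp add: ring_of_type_algebra_def)

end

interpretation of_rat: field_embedding "of_rat :: rat \<Rightarrow> complex"
  by unfold_locales (simp_all add: of_rat_add of_rat_mult)

lemma number_field_poly_quotient:
  assumes "Factorial_Ring.irreducible p"
  shows "number_field (poly_quotient p)"
proof -
  interpret poly_algebra_presentation
    "\<lambda>f. PIdl\<^bsub>ring_of_type_algebra\<^esub> p +>\<^bsub>ring_of_type_algebra\<^esub> f" p "poly_quotient p"
    by (rule poly_quotient_presentation)
  have "p \<noteq> 0" using assms by auto
  then show ?thesis
    unfolding number_field_def using algebra_M field_M[OF assms] finite_dimension_M by blast
qed

lemma poly_quotient_embeds:
  assumes "Factorial_Ring.irreducible p" "of_rat.ev p \<mu> = 0" "\<mu> \<in> rational_adjoin z"
  shows "\<exists>F. subfield F (ring_of_type_algebra :: complex ring) \<and> F \<subseteq> rational_adjoin z \<and>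
    poly_quotient p \<simeq> (ring_of_type_algebra :: complex ring) \<lparr>carrier := F\<rparr>"
proof (intro exI conjI)
  let ?F = "range (\<lambda>f. of_rat.ev f \<mu>)"
  show "subfield ?F ring_of_type_algebra" by (rule of_rat.subfield_range_ev) fact+
  have "of_rat.ev f \<mu> \<in> rational_adjoin z" for f
  proof (induction f)
    case 0
    then show ?case using rational_adjoin_of_rat[of 0] by simp
  next
    case (pCons c f)
    then show ?case
      using assms(3) by (simp add: rational_adjoin_add rational_adjoin_mult rational_adjoin_of_rat)
  qed
  then show "?F \<subseteq> rational_adjoin z" by blast
  have "poly_presentation (\<lambda>f. PIdl\<^bsub>ring_of_type_algebra\<^esub> p +>\<^bsub>ring_of_type_algebra\<^esub> f) p (poly_quotient p)"
    using poly_quotient_presentation[of p] by (simp add: poly_algebra_presentation_def)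
  from poly_presentation_ring_iso[OF this of_rat.ev_presentation[OF assms(1,2)]]
  show "poly_quotient p \<simeq> ring_of_type_algebra \<lparr>carrier := ?F\<rparr>"
    unfolding is_ring_iso_def by blast
qed

theorem theorem6p1:
  fixes S :: "'g::{finite,ab_group_add} set"
  assumes S_nonzero: "0 \<notin> S"
    and S_symmetric: "S = uminus ` S"
    and char_K: "\<not> CHAR('k::field) dvd CARD('g)"
  shows
    "((cayley_min_poly S :: 'k poly) =
        (\<Prod>\<O> \<in> (eigenvalue_orbits S :: 'k alg_closure set set). orbit_poly \<O>) \<and>
      squarefree (cayley_min_poly S :: 'k poly) \<and>
      inj_on orbit_poly (eigenvalue_orbits S :: 'k alg_closure set set) \<and>
      (\<forall>\<O> \<in> (eigenvalue_orbits S :: 'k alg_closure set set).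
         Polynomial.lead_coeff (orbit_poly \<O>) = 1 \<and> Factorial_Ring.irreducible (orbit_poly \<O>))) \<and>
     algebra_isomorphic (ring_of_type_algebra :: 'k ring)
       (spectral_algebra S :: ('k, ('k, 'g) sq_matrix) module)
       (product_algebra (eigenvalue_orbits S :: 'k alg_closure set set)
          (\<lambda>\<O>. poly_quotient (orbit_poly \<O>))) \<and>
     semisimple_ring (spectral_algebra S :: ('k, ('k, 'g) sq_matrix) module) \<and>
     (\<forall>\<zeta>. primitive_root_of_unity CARD('g) \<zeta> \<longrightarrow>
        (\<forall>\<O> \<in> (eigenvalue_orbits S :: rat alg_closure set set).
           number_field (poly_quotient (orbit_poly \<O>)) \<and>
           (\<exists>F. subfield F (ring_of_type_algebra :: complex ring) \<and>
                F \<subseteq> rational_adjoin (\<zeta> + inverse \<zeta>) \<and>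
                poly_quotient (orbit_poly \<O>) \<simeq>
                  (ring_of_type_algebra :: complex ring) \<lparr>carrier := F\<rparr>)))"
proof (intro conjI allI impI ballI)
  show "cayley_min_poly S = (\<Prod>\<O> \<in> (eigenvalue_orbits S :: 'k alg_closure set set). orbit_poly \<O>)"
    by (rule cayley_min_poly_eq[OF char_K])
  then show "squarefree (cayley_min_poly S :: 'k poly)"
    using squarefree_prod_orbit_poly[OF char_K, of S] by simp
  show "inj_on orbit_poly (eigenvalue_orbits S :: 'k alg_closure set set)" by (rule inj_on_orbit_poly)
  show "algebra_isomorphic (ring_of_type_algebra :: 'k ring)
       (spectral_algebra S :: ('k, ('k, 'g) sq_matrix) module)
       (product_algebra (eigenvalue_orbits S :: 'k alg_closure set set)
          (\<lambda>\<O>. poly_quotient (orbit_poly \<O>)))"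
    by (rule spectral_algebra_isomorphic[OF char_K])
  show "semisimple_ring (spectral_algebra S :: ('k, ('k, 'g) sq_matrix) module)"
    by (rule semisimple_spectral_algebra[OF char_K])
next
  fix \<O> :: "'k alg_closure set" assume "\<O> \<in> eigenvalue_orbits S"
  then show "Polynomial.lead_coeff (orbit_poly \<O>) = 1" "Factorial_Ring.irreducible (orbit_poly \<O>)"
    using orbit_poly_monic_irreducible[OF char_K] by blast+
next
  fix \<zeta> and \<O> :: "rat alg_closure set"
  assume \<zeta>: "primitive_root_of_unity CARD('g) \<zeta>" and \<O>: "\<O> \<in> eigenvalue_orbits S"
  have char: "\<not> CHAR(rat) dvd CARD('g)" "\<not> CHAR(complex) dvd CARD('g)" by simp_all
  have irr: "Factorial_Ring.irreducible (orbit_poly \<O>)"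
    using orbit_poly_monic_irreducible(2)[OF char(1) \<O>] .
  then show "number_field (poly_quotient (orbit_poly \<O>))" by (rule number_field_poly_quotient)
  \<comment> \<open>The orbit lies in an abstract closure of the rationals, so a complex root of its
    polynomial is obtained instead, and it is again a character sum.\<close>
  obtain \<psi> :: "'g \<Rightarrow> complex" where \<psi>: "\<psi> \<in> group_characters" "of_rat.ev (orbit_poly \<O>) (\<Sum>s\<in>S. \<psi> s) = 0"
    using orbit_poly_has_root_in_extension[OF char(1) of_rat.field_embedding_axioms char(2) \<O>] by blast
  show "\<exists>F. subfield F (ring_of_type_algebra :: complex ring) \<and>
      F \<subseteq> rational_adjoin (\<zeta> + inverse \<zeta>) \<and>
      poly_quotient (orbit_poly \<O>) \<simeq> (ring_of_type_algebra :: complex ring) \<lparr>carrier := F\<rparr>"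
    using irr \<psi>(2) complex_eigenvalue_in_rational_adjoin[OF S_symmetric \<zeta> \<psi>(1)] by (rule poly_quotient_embeds)
qed

end
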